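(* Let $(D,\mathscr{C})$ be a constrained polydifferential operator of rank $r$ and homogeneity $-2k>-n$ on $n$-manifolds. Fix a Riemannian $n$-manifold $(M,g)$, let $\mathfrak{c}=[g]$ be its conformal class, and set $w:=-(n-2k)/r$. Then $$u\cdot\Phi := \lvert J_\Phi\rvert^{-w/n}\,\Phi^\ast u$$ defines a right action of $\mathrm{Conf}(M,\mathfrak{c})$ on $C^\infty(M)$, and $U_{\mathscr{C}}^g$ is invariant under this action. Moreover, for every $\lambda\in\mathbb{R}$ and every $\Phi\in\mathrm{Conf}(M,\mathfrak{c})$, if $u\in U_{\mathscr{C}}^g$ solves $$D^g\bigl(u^{\otimes(r-1)}\bigr) = \left(\frac{n-2k}{r}\right)^{r-1}\lambda\,\lvert u\rvert^{\frac{(r-2)n+4k}{n-2k}}u ,$$ then $u\cdot\Phi$ also solves this equation.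
   Context: All tensor products are over $\mathbb{R}$. A (natural) polydifferential operator of rank $\ell+1$ ($\ell \ge 0$) on $n$-manifolds is an assignment $D$ to each Riemannian $n$-manifold $(M,g)$ of a linear operator $D^g : C^\infty(M)^{\otimes \ell} \to C^\infty(M)$ such that $D^g(u_1\otimes\cdots\otimes u_\ell)$ is expressed by a universal (coefficients independent of $(M,g)$) $\mathbb{R}$-linear combination of complete contractions, formed with $g$, of tensors $\nabla^{N_1}\mathrm{Rm}\otimes\cdots\otimes\nabla^{N_p}\mathrm{Rm}\otimes\nabla^{N_{p+1}}u_1\otimes\cdots\otimes\nabla^{N_{p+\ell}}u_\ell$, where $\mathrm{Rm}$ is the Riemann curvature tensor. It is symmetric if $D^g(u_1\otimes\cdots\otimes u_\ell)$ is invariant under permutations of the $u_j$, and conformally covariant if there are $a_1,\dots,a_\ell,b\in\mathbb{R}$ with $D^{e^{2\Upsilon}g}(u_1\otimes\cdots\otimes u_\ell)=e^{b\Upsilon}D^g(e^{-a_1\Upsilon}u_1\otimes\cdots\otimes e^{-a_\ell\Upsilon}u_\ell)$ always. $D$ has homogeneity $h$ if $D^{c^2g}=c^{h}D^g$ for all $(M,g)$ and all constants $c>0$. A formally self-adjoint, conformally covariant, polydifferential operator of rank $r\ge 1$ and homogeneity $-2k$ on $n$-manifolds is a natural polydifferential operator $D$ of rank $r$ and homogeneity $-2k$ such that (1) the Dirichlet form $\mathfrak{D}^g(u_1\otimes\cdots\otimes u_r) := \int_M u_1 D^g(u_2\otimes\cdots\otimes u_r)\,dV_g$ on $C_0^\infty(M)^{\otimes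 r}$ is invariant under permutations of $u_1,\dots,u_r$; and (2) with $w=-\frac{n-2k}{r}$, if $\hat g=e^{2\Upsilon}g$ then $\mathfrak{D}^{\hat g}(e^{w\Upsilon}u_1\otimes\cdots\otimes e^{w\Upsilon}u_r)=\mathfrak{D}^g(u_1\otimes\cdots\otimes u_r)$. A constrained polydifferential operator of rank $r$ and homogeneity $-2k$ on $n$-manifolds is a pair $(D,\mathscr{C})$ of such an operator $D$ and a (possibly empty) finite set $\mathscr{C}$ of symmetric conformally covariant polydifferential operators such that for each $C\in\mathscr{C}$, with $r(C)$ the rank of $C$, there is a $b(C)\in\mathbb{R}$ with $C^{e^{2\Upsilon}g}\bigl(u^{\otimes(r(C)-1)}\bigr)=e^{b(C)\Upsilon}C^g\bigl((e^{\frac{n-2k}{r}\Upsilon}u)^{\otimes(r(C)-1)}\bigr)$ for all $(M,g)$ and all $\Upsilon,u\in C^\infty(M)$. Its constrained cone is $U_{\mathscr{C}}^g := \{u\in C^\infty(M) : C^g(u^{\otimes(r(C)-1)})>0 \text{ for all } C\in\mathscr{C}\}$. $\mathrm{Conf}(M,\mathfrak{c})$ is the group, under composition, of diffeomorphisms $\Phi$ of $M$ with $\Phi^\ast g\in\mathfrak{c}$. The Jacobian determinant $\lvert J_\Phi\rvert$ is the positive function defined by $dV_{\Phi^\ast g}=\lvert J_\Phi\rvert\,dV_g$. *)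

theory Defs
  imports "HOL-Analysis.Analysis" "HOL-Algebra.Bij"
begin

text \<open>
  Conventions. A manifold has its points in an arbitrary type \<open>'a\<close> (the underlying set is the
  carrier of a topology on a subset of \<open>'a\<close>) and dimension \<open>CARD('n)\<close>. ``For all manifolds'' means
  all those with points in \<open>'a\<close>; as soon as \<open>'a\<close> has at least continuum many elements this
  includes a copy of every manifold.

  Partially defined mathematical objects (functions on a manifold, metrics, tangent vectors) are
  represented by total functions that vanish outside their natural domain. Thus they are equal as
  mathematical objects iff they are equal in HOL.
\<close>

subsection \<open>Smooth functions on open subsets of Euclidean space\<close>

definition partial :: "'n::finite \<Rightarrow> (real^'n \<Rightarrow> real) \<Rightarrow> real^'n \<Rightarrow> real" where
  "partial i f x = frechet_derivative f (at x) (axis i 1)"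

fun Ck_on :: "nat \<Rightarrow> (real^'n::finite) set \<Rightarrow> (real^'n \<Rightarrow> real) \<Rightarrow> bool" where
  "Ck_on 0 S f = continuous_on S f"
| "Ck_on (Suc k) S f = (f differentiable_on S \<and> (\<forall>i. Ck_on k S (partial i f)))"

definition smooth_on :: "(real^'n::finite) set \<Rightarrow> (real^'n \<Rightarrow> real) \<Rightarrow> bool" where
  "smooth_on S f \<longleftrightarrow> (\<forall>k. Ck_on k S f)"

subsection \<open>Smooth manifolds\<close>

type_synonym ('a, 'n) chart = "'a set \<times> ('a \<Rightarrow> real^'n)"

record ('a, 'n::finite) manifold =
  mtop :: "'a topology"
  atlas :: "('a, 'n) chart set"

abbreviation points :: "('a, 'n::finite) manifold \<Rightarrow> 'a set" where
  "points M \<equiv> topspace (mtop M)"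

abbreviation cdom :: "('a, 'n::finite) chart \<Rightarrow> 'a set" where
  "cdom c \<equiv> fst c"

abbreviation cimage :: "('a, 'n::finite) chart \<Rightarrow> (real^'n) set" where
  "cimage c \<equiv> snd c ` fst c"

definition cinv :: "('a, 'n::finite) chart \<Rightarrow> real^'n \<Rightarrow> 'a" where
  "cinv c = inv_into (fst c) (snd c)"

definition topological_chart :: "'a topology \<Rightarrow> ('a, 'n::finite) chart \<Rightarrow> bool" where
  "topological_chart X c \<longleftrightarrow>
     openin X (cdom c) \<and> open (cimage c) \<and>
     homeomorphic_map (subtopology X (cdom c)) (top_of_set (cimage c)) (snd c)"

definition smooth_transition :: "('a, 'n::finite) chart \<Rightarrow> ('a, 'n) chart \<Rightarrow> bool" where
  "smooth_transition c d \<longleftrightarrow>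
     (\<forall>i. smooth_on (snd c ` (cdom c \<inter> cdom d)) (\<lambda>x. snd d (cinv c x) $ i))"

definition compatible :: "('a, 'n::finite) chart \<Rightarrow> ('a, 'n) chart \<Rightarrow> bool" where
  "compatible c d \<longleftrightarrow> smooth_transition c d \<and> smooth_transition d c"

definition smooth_manifold :: "('a, 'n::finite) manifold \<Rightarrow> bool" where
  "smooth_manifold M \<longleftrightarrow>
     Hausdorff_space (mtop M) \<and> second_countable (mtop M) \<and>
     (\<forall>c\<in>atlas M. topological_chart (mtop M) c) \<and>
     (\<Union>c\<in>atlas M. cdom c) = points M \<and>
     (\<forall>c\<in>atlas M. \<forall>d\<in>atlas M. compatible c d) \<and>
     (\<forall>c. topological_chart (mtop M) c \<and> (\<forall>d\<in>atlas M. compatible c d) \<longrightarrow> c \<in> atlas M)"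

definition C_inf :: "('a, 'n::finite) manifold \<Rightarrow> ('a \<Rightarrow> real) set" where
  "C_inf M = {u. (\<forall>p. p \<notin> points M \<longrightarrow> u p = 0) \<and>
                 (\<forall>c\<in>atlas M. smooth_on (cimage c) (\<lambda>x. u (cinv c x)))}"

definition C_inf_compact :: "('a, 'n::finite) manifold \<Rightarrow> ('a \<Rightarrow> real) set" where
  "C_inf_compact M = {u \<in> C_inf M. \<exists>K. compactin (mtop M) K \<and> (\<forall>p. p \<notin> K \<longrightarrow> u p = 0)}"

definition smooth_map :: "('a, 'n::finite) manifold \<Rightarrow> ('a, 'n) manifold \<Rightarrow> ('a \<Rightarrow> 'a) \<Rightarrow> bool" where
  "smooth_map M N F \<longleftrightarrow>
     continuous_map (mtop M) (mtop N) F \<and>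
     (\<forall>c\<in>atlas M. \<forall>d\<in>atlas N. \<forall>i.
        smooth_on (snd c ` {p \<in> cdom c. F p \<in> cdom d}) (\<lambda>x. snd d (F (cinv c x)) $ i))"

text \<open>Elements of \<open>Bij S\<close> are the bijections of \<open>S\<close> taking the value \<open>undefined\<close> off \<open>S\<close>.\<close>

definition diffeos :: "('a, 'n::finite) manifold \<Rightarrow> ('a \<Rightarrow> 'a) set" where
  "diffeos M = {F \<in> Bij (points M).
     smooth_map M M F \<and> smooth_map M M (restrict (inv_into (points M) F) (points M))}"

definition pullback :: "('a, 'n::finite) manifold \<Rightarrow> ('a \<Rightarrow> 'a) \<Rightarrow> ('a \<Rightarrow> real) \<Rightarrow> 'a \<Rightarrow> real" where
  "pullback M F u = (\<lambda>p. if p \<in> points M then u (F p) else 0)"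

subsection \<open>Tangent vectors and Riemannian metrics\<close>

text \<open>Tangent vectors are derivations of \<^term>\<open>C_inf M\<close>.\<close>

type_synonym 'a tvec = "('a \<Rightarrow> real) \<Rightarrow> real"

definition tangent_space :: "('a, 'n::finite) manifold \<Rightarrow> 'a \<Rightarrow> 'a tvec set" where
  "tangent_space M p = {v.
     (\<forall>f. f \<notin> C_inf M \<longrightarrow> v f = 0) \<and>
     (\<forall>f\<in>C_inf M. \<forall>h\<in>C_inf M. \<forall>a b. v (\<lambda>q. a * f q + b * h q) = a * v f + b * v h) \<and>
     (\<forall>f\<in>C_inf M. \<forall>h\<in>C_inf M. v (\<lambda>q. f q * h q) = f p * v h + h p * v f)}"

definition coord_vec :: "('a, 'n::finite) manifold \<Rightarrow> ('a, 'n) chart \<Rightarrow> 'n \<Rightarrow> 'a \<Rightarrow> 'a tvec" where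
  "coord_vec M c i p =
     (\<lambda>f. if f \<in> C_inf M then partial i (\<lambda>x. f (cinv c x)) (snd c p) else 0)"

definition pushforward :: "('a, 'n::finite) manifold \<Rightarrow> ('a \<Rightarrow> 'a) \<Rightarrow> 'a tvec \<Rightarrow> 'a tvec" where
  "pushforward M F v = (\<lambda>f. if f \<in> C_inf M then v (pullback M F f) else 0)"

type_synonym 'a metric = "'a \<Rightarrow> 'a tvec \<Rightarrow> 'a tvec \<Rightarrow> real"

definition metric_coords ::
    "('a, 'n::finite) manifold \<Rightarrow> 'a metric \<Rightarrow> ('a, 'n) chart \<Rightarrow> real^'n \<Rightarrow> real^'n^'n" where
  "metric_coords M g c x =
     (\<chi> i j. g (cinv c x) (coord_vec M c i (cinv c x)) (coord_vec M c j (cinv c x)))"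

definition riemannian_metric :: "('a, 'n::finite) manifold \<Rightarrow> 'a metric \<Rightarrow> bool" where
  "riemannian_metric M g \<longleftrightarrow>
     (\<forall>p v w. \<not> (p \<in> points M \<and> v \<in> tangent_space M p \<and> w \<in> tangent_space M p)
        \<longrightarrow> g p v w = 0) \<and>
     (\<forall>p\<in>points M. \<forall>u\<in>tangent_space M p. \<forall>v\<in>tangent_space M p. \<forall>w\<in>tangent_space M p.
        g p v w = g p w v \<and>
        (\<forall>a b. g p (\<lambda>f. a * u f + b * v f) w = a * g p u w + b * g p v w) \<and>
        (v \<noteq> (\<lambda>_. 0) \<longrightarrow> g p v v > 0)) \<and>
     (\<forall>c\<in>atlas M. \<forall>i j. smooth_on (cimage c) (\<lambda>x. metric_coords M g c x $ i $ j))"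

definition riemannian_manifold :: "('a, 'n::finite) manifold \<Rightarrow> 'a metric \<Rightarrow> bool" where
  "riemannian_manifold M g \<longleftrightarrow> smooth_manifold M \<and> riemannian_metric M g"

definition pullback_metric ::
    "('a, 'n::finite) manifold \<Rightarrow> ('a \<Rightarrow> 'a) \<Rightarrow> 'a metric \<Rightarrow> 'a metric" where
  "pullback_metric M F g = (\<lambda>p v w.
     if p \<in> points M \<and> v \<in> tangent_space M p \<and> w \<in> tangent_space M p
     then g (F p) (pushforward M F v) (pushforward M F w) else 0)"

definition scale_metric :: "real \<Rightarrow> 'a metric \<Rightarrow> 'a metric" where
  "scale_metric a g = (\<lambda>p v w. a * g p v w)"

definition conf_metric :: "('a \<Rightarrow> real) \<Rightarrow> 'a metric \<Rightarrow> 'a metric" where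
  "conf_metric \<Upsilon> g = (\<lambda>p v w. exp (2 * \<Upsilon> p) * g p v w)"

definition exp_mult :: "real \<Rightarrow> ('a \<Rightarrow> real) \<Rightarrow> ('a \<Rightarrow> real) \<Rightarrow> 'a \<Rightarrow> real" where
  "exp_mult s \<Upsilon> u = (\<lambda>p. exp (s * \<Upsilon> p) * u p)"

definition conformal_class :: "('a, 'n::finite) manifold \<Rightarrow> 'a metric \<Rightarrow> 'a metric set" where
  "conformal_class M g = {conf_metric \<Upsilon> g | \<Upsilon>. \<Upsilon> \<in> C_inf M}"

subsection \<open>Riemannian volume\<close>

text \<open>
  The manifold is cut into countably many Borel pieces, each contained in one chart, and the
  measure is \<open>sqrt (det g) dx\<close> on each piece. By the change of variables formula the result does
  not depend on the chosen sequence of charts.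
\<close>

definition chart_seq :: "('a, 'n::finite) manifold \<Rightarrow> nat \<Rightarrow> ('a, 'n) chart" where
  "chart_seq M = (SOME cs. range cs \<subseteq> atlas M \<and> (\<Union>i. cdom (cs i)) = points M)"

definition chart_piece :: "('a, 'n::finite) manifold \<Rightarrow> nat \<Rightarrow> 'a set" where
  "chart_piece M i = cdom (chart_seq M i) - (\<Union>j<i. cdom (chart_seq M j))"

definition vol :: "('a, 'n::finite) manifold \<Rightarrow> 'a metric \<Rightarrow> 'a measure" where
  "vol M g = measure_of (points M) {U. openin (mtop M) U}
     (\<lambda>A. \<Sum>i. \<integral>\<^sup>+x. ennreal (sqrt (det (metric_coords M g (chart_seq M i) x))) *
               indicator (snd (chart_seq M i) ` (A \<inter> chart_piece M i)) x \<partial>lborel)"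

definition jacobian :: "('a, 'n::finite) manifold \<Rightarrow> 'a metric \<Rightarrow> ('a \<Rightarrow> 'a) \<Rightarrow> 'a \<Rightarrow> real" where
  "jacobian M g F = (THE J. J \<in> C_inf M \<and> (\<forall>p\<in>points M. J p > 0) \<and>
     vol M (pullback_metric M F g) = density (vol M g) (\<lambda>p. ennreal (J p)))"

subsection \<open>Covariant derivatives, curvature and complete contractions in coordinates\<close>

definition christoffel ::
    "(real^'n::finite \<Rightarrow> real^'n^'n) \<Rightarrow> 'n \<Rightarrow> 'n \<Rightarrow> 'n \<Rightarrow> real^'n \<Rightarrow> real" where
  "christoffel G l i j x = 1/2 * (\<Sum>m\<in>UNIV. matrix_inv (G x) $ l $ m *
     (partial i (\<lambda>y. G y $ j $ m) x + partial j (\<lambda>y. G y $ i $ m) x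
        - partial m (\<lambda>y. G y $ i $ j) x))"

text \<open>
  A covariant tensor field of rank \<open>m\<close> on a coordinate domain is given by its components, indexed
  by the lists of length \<open>m\<close>. In \<open>cov_deriv\<close> the index of differentiation comes first.
\<close>

type_synonym 'n tensor = "'n list \<Rightarrow> real^'n \<Rightarrow> real"

definition cov_deriv ::
    "(real^'n::finite \<Rightarrow> real^'n^'n) \<Rightarrow> 'n tensor \<Rightarrow> 'n tensor" where
  "cov_deriv G T I x = (case I of [] \<Rightarrow> 0 | k # J \<Rightarrow>
     partial k (T J) x -
     (\<Sum>s<length J. \<Sum>l\<in>UNIV. christoffel G l k (J ! s) x * T (J[s := l]) x))"

text \<open>\<open>R\<^sub>i\<^sub>j\<^sub>k\<^sub>l = g(R(e\<^sub>i, e\<^sub>j) e\<^sub>k, e\<^sub>l)\<close> for the index list \<open>[i, j, k, l]\<close>\<close>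

definition riemann :: "(real^'n::finite \<Rightarrow> real^'n^'n) \<Rightarrow> 'n tensor" where
  "riemann G I x = (let i = I ! 0; j = I ! 1; k = I ! 2; l = I ! 3 in
     \<Sum>m\<in>UNIV. G x $ l $ m *
       (partial i (christoffel G m j k) x - partial j (christoffel G m i k) x +
        (\<Sum>q\<in>UNIV. christoffel G m i q x * christoffel G q j k x
                 - christoffel G m j q x * christoffel G q i k x)))"

fun tensor_prod :: "(nat \<times> ('n::finite) tensor) list \<Rightarrow> 'n tensor" where
  "tensor_prod [] I x = 1"
| "tensor_prod ((m, T) # Ts) I x = T (take m I) x * tensor_prod Ts (drop m I) x"

text \<open>
  A complete contraction of a tensor of even rank \<open>m\<close> is described by a perfect matching \<open>P\<close>
  of the index positions \<open>{..<m}\<close>, given as a list of pairs.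
\<close>

definition perfect_matching :: "nat \<Rightarrow> (nat \<times> nat) list \<Rightarrow> bool" where
  "perfect_matching m P \<longleftrightarrow>
     distinct (map fst P @ map snd P) \<and> set (map fst P @ map snd P) = {..<m}"

definition complete_contraction ::
    "(real^'n::finite \<Rightarrow> real^'n^'n) \<Rightarrow> (nat \<times> nat) list \<Rightarrow> 'n tensor \<Rightarrow> real^'n \<Rightarrow> real" where
  "complete_contraction G P T x =
     (\<Sum>I | length I = 2 * length P.
        (\<Prod>(a, b)\<leftarrow>P. matrix_inv (G x) $ (I ! a) $ (I ! b)) * T I x)"

text \<open>
  The term \<open>(a, Ns, Ks, P)\<close> stands for \<open>a\<close> times the complete contraction, along \<open>P\<close>, of the tensor
  product of the \<open>\<nabla>\<^sup>N Rm\<close>, \<open>N\<close> in \<open>Ns\<close>, and of the \<open>\<nabla>\<^sup>K u\<close>, with \<open>K\<close> in \<open>Ks\<close> and \<open>u\<close> in \<open>us\<close>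
  running in parallel.
\<close>

type_synonym nat_term = "real \<times> nat list \<times> nat list \<times> (nat \<times> nat) list"

fun wf_term :: "nat \<Rightarrow> nat_term \<Rightarrow> bool" where
  "wf_term l (a, Ns, Ks, P) \<longleftrightarrow> length Ks = l \<and>
     perfect_matching (sum_list (map (\<lambda>N. N + 4) Ns) + sum_list Ks) P"

fun eval_term ::
    "(real^'n::finite \<Rightarrow> real^'n^'n) \<Rightarrow> (real^'n \<Rightarrow> real) list \<Rightarrow> nat_term \<Rightarrow> real^'n \<Rightarrow> real" where
  "eval_term G us (a, Ns, Ks, P) x = a * complete_contraction G P (tensor_prod
     (map (\<lambda>N. (N + 4, (cov_deriv G ^^ N) (riemann G))) Ns @
      map (\<lambda>(K, u). (K, (cov_deriv G ^^ K) (\<lambda>_. u))) (zip Ks us))) x"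

subsection \<open>Polydifferential operators\<close>

text \<open>
  Linear maps out of the \<open>l\<close>-fold tensor power of \<^term>\<open>C_inf M\<close> are represented as multilinear
  maps of \<open>l\<close> arguments, given as lists of length \<open>l\<close>. A rank is not determined by the HOL function
  alone and is supplied separately.
\<close>

type_synonym ('a, 'n) polydiff =
  "('a, 'n) manifold \<Rightarrow> 'a metric \<Rightarrow> ('a \<Rightarrow> real) list \<Rightarrow> 'a \<Rightarrow> real"

abbreviation tuples :: "'b set \<Rightarrow> nat \<Rightarrow> 'b list set" where
  "tuples A l \<equiv> {us. set us \<subseteq> A \<and> length us = l}"

definition multilinear_on ::
    "('a, 'n::finite) manifold \<Rightarrow> nat \<Rightarrow> (('a \<Rightarrow> real) list \<Rightarrow> 'a \<Rightarrow> real) \<Rightarrow> bool" where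
  "multilinear_on M l B \<longleftrightarrow>
     (\<forall>us\<in>tuples (C_inf M) l. B us \<in> C_inf M) \<and>
     (\<forall>us\<in>tuples (C_inf M) l. \<forall>j<l. \<forall>v\<in>C_inf M. \<forall>w\<in>C_inf M. \<forall>a b.
        B (us[j := (\<lambda>p. a * v p + b * w p)]) =
        (\<lambda>p. a * B (us[j := v]) p + b * B (us[j := w]) p))"

definition polydiff_op :: "nat \<Rightarrow> ('a, 'n::finite) polydiff \<Rightarrow> bool" where
  "polydiff_op r D \<longleftrightarrow> r \<ge> 1 \<and>
     (\<forall>M g. riemannian_manifold M g \<longrightarrow> multilinear_on M (r - 1) (D M g)) \<and>
     (\<exists>ts. (\<forall>t\<in>set ts. wf_term (r - 1) t) \<and>
        (\<forall>M g us. riemannian_manifold M g \<and> us \<in> tuples (C_inf M) (r - 1) \<longrightarrow>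
          (\<forall>c\<in>atlas M. \<forall>p\<in>cdom c. D M g us p =
             (\<Sum>t\<leftarrow>ts. eval_term (metric_coords M g c) (map (\<lambda>u x. u (cinv c x)) us) t (snd c p)))))"

definition symmetric_op :: "nat \<Rightarrow> ('a, 'n::finite) polydiff \<Rightarrow> bool" where
  "symmetric_op r D \<longleftrightarrow>
     (\<forall>M g us vs. riemannian_manifold M g \<and> us \<in> tuples (C_inf M) (r - 1) \<and> mset vs = mset us
        \<longrightarrow> D M g vs = D M g us)"

definition conformally_covariant :: "nat \<Rightarrow> ('a, 'n::finite) polydiff \<Rightarrow> bool" where
  "conformally_covariant r D \<longleftrightarrow>
     (\<exists>as b. length as = r - 1 \<and>
        (\<forall>M g \<Upsilon> us. riemannian_manifold M g \<and> \<Upsilon> \<in> C_inf M \<and> us \<in> tuples (C_inf M) (r - 1) \<longrightarrow>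
           D M (conf_metric \<Upsilon> g) us =
           exp_mult b \<Upsilon> (D M g (map2 (\<lambda>a u. exp_mult (- a) \<Upsilon> u) as us))))"

definition homogeneous_op :: "nat \<Rightarrow> real \<Rightarrow> ('a, 'n::finite) polydiff \<Rightarrow> bool" where
  "homogeneous_op r h D \<longleftrightarrow>
     (\<forall>M g c us. riemannian_manifold M g \<and> c > 0 \<and> us \<in> tuples (C_inf M) (r - 1) \<longrightarrow>
        D M (scale_metric (c\<^sup>2) g) us = (\<lambda>p. (c powr h) * D M g us p))"

definition dirichlet_form ::
    "('a, 'n::finite) polydiff \<Rightarrow> ('a, 'n) manifold \<Rightarrow> 'a metric \<Rightarrow> ('a \<Rightarrow> real) list \<Rightarrow> real" where
  "dirichlet_form D M g us = (\<integral>p. hd us p * D M g (tl us) p \<partial>vol M g)"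

text \<open>Formally self-adjoint, conformally covariant, of rank \<open>r\<close> and homogeneity \<open>-2k\<close>\<close>

definition fsa_conf_cov_op :: "nat \<Rightarrow> real \<Rightarrow> ('a, 'n::finite) polydiff \<Rightarrow> bool" where
  "fsa_conf_cov_op r k D \<longleftrightarrow>
     polydiff_op r D \<and> homogeneous_op r (- 2 * k) D \<and>
     (\<forall>M g us vs. riemannian_manifold M g \<and> us \<in> tuples (C_inf_compact M) r \<and> mset vs = mset us
        \<longrightarrow> dirichlet_form D M g vs = dirichlet_form D M g us) \<and>
     (let w = - (real CARD('n) - 2 * k) / real r in
      \<forall>M g \<Upsilon> us. riemannian_manifold M g \<and> \<Upsilon> \<in> C_inf M \<and> us \<in> tuples (C_inf_compact M) r \<longrightarrow>
        dirichlet_form D M (conf_metric \<Upsilon> g) (map (exp_mult w \<Upsilon>) us) = dirichlet_form D M g us)"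

text \<open>The constraints are pairs of a rank and an operator of that rank.\<close>

definition constrained_polydiff_op ::
    "nat \<Rightarrow> real \<Rightarrow> ('a, 'n::finite) polydiff \<Rightarrow> (nat \<times> ('a, 'n) polydiff) set \<Rightarrow> bool" where
  "constrained_polydiff_op r k D \<C> \<longleftrightarrow>
     fsa_conf_cov_op r k D \<and> finite \<C> \<and>
     (\<forall>(s, C)\<in>\<C>. polydiff_op s C \<and> symmetric_op s C \<and> conformally_covariant s C \<and>
        (\<exists>b. \<forall>M g \<Upsilon> u. riemannian_manifold M g \<and> \<Upsilon> \<in> C_inf M \<and> u \<in> C_inf M \<longrightarrow>
           C M (conf_metric \<Upsilon> g) (replicate (s - 1) u) =
           exp_mult b \<Upsilon> (C M g (replicate (s - 1)
             (exp_mult ((real CARD('n) - 2 * k) / real r) \<Upsilon> u)))))"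

definition constrained_cone ::
    "('a, 'n::finite) manifold \<Rightarrow> 'a metric \<Rightarrow> (nat \<times> ('a, 'n) polydiff) set \<Rightarrow> ('a \<Rightarrow> real) set" where
  "constrained_cone M g \<C> =
     {u \<in> C_inf M. \<forall>(s, C)\<in>\<C>. \<forall>p\<in>points M. C M g (replicate (s - 1) u) p > 0}"

subsection \<open>The conformal group and its action\<close>

definition conf_group :: "('a, 'n::finite) manifold \<Rightarrow> 'a metric \<Rightarrow> ('a \<Rightarrow> 'a) monoid" where
  "conf_group M g =
     \<lparr>carrier = {F \<in> diffeos M. pullback_metric M F g \<in> conformal_class M g},
      monoid.mult = compose (points M),
      one = restrict id (points M)\<rparr>"

definition right_action :: "('b, 'c) monoid_scheme \<Rightarrow> 'e set \<Rightarrow> ('e \<Rightarrow> 'b \<Rightarrow> 'e) \<Rightarrow> bool" where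
  "right_action G E act \<longleftrightarrow> group G \<and>
     (\<forall>x\<in>E. \<forall>a\<in>carrier G. act x a \<in> E) \<and>
     (\<forall>x\<in>E. act x \<one>\<^bsub>G\<^esub> = x) \<and>
     (\<forall>x\<in>E. \<forall>a\<in>carrier G. \<forall>b\<in>carrier G. act x (a \<otimes>\<^bsub>G\<^esub> b) = act (act x a) b)"

definition conf_act ::
    "('a, 'n::finite) manifold \<Rightarrow> 'a metric \<Rightarrow> real \<Rightarrow> ('a \<Rightarrow> real) \<Rightarrow> ('a \<Rightarrow> 'a) \<Rightarrow> 'a \<Rightarrow> real" where
  "conf_act M g w u F =
     (\<lambda>p. (jacobian M g F p) powr (- w / real CARD('n)) * pullback M F u p)"

end

theory Submission
  imports Defs
begin

text \<open>
  If \<open>\<Phi>\<close> pulls \<open>g\<close> back to \<open>exp (2\<Upsilon>) g\<close>, then its Jacobian is \<open>exp (n\<Upsilon>)\<close>, so \<open>u \<cdot> \<Phi>\<close> is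
  \<open>exp (-w\<Upsilon>)\<close> times the pullback of \<open>u\<close>, and the action law is the cocycle identity for \<open>\<Upsilon>\<close>.
  Natural operators commute with the pullback by a diffeomorphism: a chart at \<open>\<Phi> p\<close> composed with \<open>\<Phi>\<close>
  is a chart at \<open>p\<close> in which the pulled back metric and functions have the same coordinate expressions as
  the original ones. Testing the invariance of the Dirichlet form against bump functions gives the
  pointwise law \<open>D g (u, \<dots>) = exp ((n + w)\<Upsilon>) D (exp (2\<Upsilon>) g) (exp (w\<Upsilon>) u, \<dots>)\<close>, and the
  invariance of the equation is then a count of exponents.
\<close>

subsection \<open>Smooth functions on Euclidean space\<close>

text \<open>The measure \<open>vol M g\<close> is glued from a chosen sequence of charts, so showing
  how it transforms under a diffeomorphism would take the change of variables formula. The proof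
  never compares measures along \<Phi>. The Jacobian is characterised by the volume of the pulled
  back metric, and for conformal \<Phi> this metric is \<open>conf_metric \<Upsilon> g\<close> on
  the same manifold, cut into the same pieces; only the factor \<open>sqrt (det ...)\<close>
  changes. The price is uniqueness: \<open>jacobian\<close> is a definite description, so a smooth
  density of \<open>vol M g\<close> must be shown to be determined pointwise. The same fact makes
  the invariance of the Dirichlet form pointwise; it is what calls for bump functions, positive
  determinants and integrals concentrated in one piece.

  The exponent q of the equation is forced. Its left side acquires exp ((n + w) \<Upsilon>), while
  |u|^q u acquires exp (- w (q + 1) \<Upsilon>). Equating the two gives q = - (n + 2 w) / w, which
  is ((r - 2) n + 4 k) / (n - 2 k).\<close>

lemma partial_unique:
  assumes "(f has_derivative f') (at x)"
  shows "partial i f x = f' (axis i 1)"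
  using frechet_derivative_at[OF assms] by (simp add: partial_def)

text \<open>\<open>frechet_derivative\<close> is a choice among all derivatives at \<open>x\<close>,
  and the set of these depends only on the germ of the function. Hence equality holds even where no
  derivative exists, and the later congruences for curvature carry no smoothness hypotheses.\<close>

lemma partial_cong_open:
  assumes "open S" "x \<in> S" "\<And>y. y \<in> S \<Longrightarrow> f y = g y"
  shows "partial i f x = partial i g x"
proof -
  have "(f has_derivative f') (at x) \<longleftrightarrow> (g has_derivative f') (at x)" for f'
    using has_derivative_transform_within_open[of f f' x UNIV S g]
          has_derivative_transform_within_open[of g f' x UNIV S f] assms by auto
  then show ?thesis by (simp add: partial_def frechet_derivative_def)
qed

lemma partial_add:
  assumes "f differentiable (at x)" "g differentiable (at x)"
  shows "partial i (\<lambda>x. f x + g x) x = partial i f x + partial i g x"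
  using partial_unique[OF has_derivative_add] assms unfolding frechet_derivative_works partial_def by blast

lemma partial_mult:
  assumes "f differentiable (at x)" "g differentiable (at x)"
  shows "partial i (\<lambda>x. f x * g x) x = partial i f x * g x + f x * partial i g x"
proof -
  have "((\<lambda>x. f x * g x) has_derivative
      (\<lambda>v. f x * frechet_derivative g (at x) v + frechet_derivative f (at x) v * g x)) (at x)"
    using assms unfolding frechet_derivative_works by (rule has_derivative_mult)
  from partial_unique[OF this] show ?thesis by (simp add: partial_def)
qed

lemma partial_const [simp]: "partial i (\<lambda>_. c) x = 0"
  by (simp add: partial_def)

lemma has_derivative_components:
  fixes h :: "real^'n::finite \<Rightarrow> real^'m::finite"
  assumes "\<And>j. (\<lambda>x. h x $ j) differentiable (at x)"
  shows "(h has_derivative (\<lambda>v. \<chi> j. frechet_derivative (\<lambda>x. h x $ j) (at x) v)) (at x)"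
proof -
  have "((\<lambda>x. \<Sum>j\<in>UNIV. (h x $ j) *\<^sub>R (axis j 1 :: real^'m)) has_derivative
         (\<lambda>v. \<Sum>j\<in>UNIV. frechet_derivative (\<lambda>x. h x $ j) (at x) v *\<^sub>R (axis j 1 :: real^'m))) (at x)"
    using assms unfolding frechet_derivative_works
    by (intro has_derivative_sum has_derivative_scaleR_left) auto
  moreover have expand: "(\<Sum>j\<in>UNIV. (y $ j) *\<^sub>R axis j 1) = y" for y :: "real^'m"
    using basis_expansion[of y] by (simp add: scalar_mult_eq_scaleR)
  moreover have "(\<Sum>j\<in>UNIV. a j *\<^sub>R axis j 1) = (\<chi> j. a j)" for a :: "'m \<Rightarrow> real"
    using expand[of "\<chi> j. a j"] by simp
  ultimately show ?thesis by simp
qed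

text \<open>Smoothness is defined for real-valued functions only, so the inner map enters through
  its components.\<close>

lemma partial_comp:
  fixes h :: "real^'n::finite \<Rightarrow> real^'m::finite"
  assumes f: "f differentiable (at (h x))" and h: "\<And>j. (\<lambda>x. h x $ j) differentiable (at x)"
  shows "(\<lambda>x. f (h x)) differentiable (at x)"
    and "partial i (\<lambda>x. f (h x)) x = (\<Sum>j\<in>UNIV. partial j f (h x) * partial i (\<lambda>x. h x $ j) x)"
proof -
  let ?f' = "frechet_derivative f (at (h x))"
  let ?h' = "\<lambda>v. \<chi> j. frechet_derivative (\<lambda>x. h x $ j) (at x) v"
  have *: "((\<lambda>x. f (h x)) has_derivative (\<lambda>v. ?f' (?h' v))) (at x)"
    using has_derivative_compose[OF has_derivative_components[OF h]] f
    unfolding frechet_derivative_works by blast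
  then show "(\<lambda>x. f (h x)) differentiable (at x)"
    by (rule differentiableI)
  have lin: "linear ?f'"
    using f by (rule linear_frechet_derivative)
  have "partial i (\<lambda>x. f (h x)) x = ?f' (?h' (axis i 1))"
    using partial_unique[OF *] .
  also have "?h' (axis i 1) = (\<Sum>j\<in>UNIV. (?h' (axis i 1) $ j) *\<^sub>R axis j 1)"
    using basis_expansion[of "?h' (axis i 1)"] by (simp add: scalar_mult_eq_scaleR)
  also have "?f' \<dots> = (\<Sum>j\<in>UNIV. partial j f (h x) * partial i (\<lambda>x. h x $ j) x)"
    by (simp add: linear_sum[OF lin] linear_scale[OF lin] partial_def mult.commute)
  finally show "partial i (\<lambda>x. f (h x)) x = \<dots>" .
qed

lemma partial_comp_real:
  assumes f: "(f has_real_derivative f') (at (h x))" and h: "h differentiable (at x)"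
  shows "(\<lambda>x. f (h x)) differentiable (at x)"
    and "partial i (\<lambda>x. f (h x)) x = f' * partial i h x"
proof -
  have *: "((\<lambda>x. f (h x)) has_derivative (\<lambda>v. f' * frechet_derivative h (at x) v)) (at x)"
    using has_derivative_compose[of h "frechet_derivative h (at x)" x UNIV f "(*) f'"] f h
    unfolding frechet_derivative_works has_field_derivative_def by simp
  then show "(\<lambda>x. f (h x)) differentiable (at x)"
    by (rule differentiableI)
  show "partial i (\<lambda>x. f (h x)) x = f' * partial i h x"
    using partial_unique[OF *] by (simp add: partial_def)
qed

section \<open>Smoothness as a local and coinductive property\<close>

lemma Ck_on_cong:
  assumes "open S" "Ck_on k S f" "\<And>x. x \<in> S \<Longrightarrow> f x = g x"
  shows "Ck_on k S g"
  using assms(2,3)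
proof (induction k arbitrary: f g)
  case 0
  then show ?case by (simp cong: continuous_on_cong_simp)
next
  case (Suc k)
  have "g differentiable_on S"
    using Suc.prems by (metis Ck_on.simps(2) differentiable_on_def differentiable_transform_within zero_less_one)
  moreover have "Ck_on k S (partial i g)" for i
    using Suc.IH[of "partial i f" "partial i g"] Suc.prems partial_cong_open[OF assms(1)]
    by (metis Ck_on.simps(2))
  ultimately show ?case by simp
qed

lemma smooth_on_cong:
  assumes "open S" "smooth_on S f" "\<And>x. x \<in> S \<Longrightarrow> f x = g x"
  shows "smooth_on S g"
  using assms Ck_on_cong unfolding smooth_on_def by blast

lemma smooth_on_differentiable:
  assumes "open S" "smooth_on S f" "x \<in> S"
  shows "f differentiable (at x)"
proof -
  have "Ck_on (Suc 0) S f" using assms by (auto simp: smooth_on_def)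
  then show ?thesis using assms
    by (simp add: differentiable_on_eq_differentiable_at)
qed

lemma smooth_on_partial:
  "smooth_on S f \<Longrightarrow> smooth_on S (partial i f)"
  unfolding smooth_on_def by (metis Ck_on.simps(2))

lemma smooth_on_continuous: "smooth_on S f \<Longrightarrow> continuous_on S f"
  unfolding smooth_on_def by (metis Ck_on.simps(1))

lemma Ck_on_subset: "Ck_on k T f \<Longrightarrow> S \<subseteq> T \<Longrightarrow> Ck_on k S f"
  by (induction k arbitrary: f) (auto intro: continuous_on_subset differentiable_on_subset)

lemma smooth_on_subset: "smooth_on T f \<Longrightarrow> S \<subseteq> T \<Longrightarrow> smooth_on S f"
  unfolding smooth_on_def by (blast intro: Ck_on_subset)

lemma Ck_on_local:
  assumes "open S" and "\<And>x. x \<in> S \<Longrightarrow> \<exists>U. open U \<and> x \<in> U \<and> Ck_on k U f"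
  shows "Ck_on k S f"
  using assms(2)
proof (induction k arbitrary: f)
  case 0
  then show ?case using assms(1)
    by (auto simp: continuous_on_eq_continuous_at) (metis continuous_on_eq_continuous_at)
next
  case (Suc k)
  have "f differentiable (at x)" if "x \<in> S" for x
    using Suc.prems[OF that] by (auto simp: differentiable_on_eq_differentiable_at)
  moreover have "Ck_on k S (partial i f)" for i
    by (rule Suc.IH) (use Suc.prems in fastforce)
  ultimately show ?case using assms(1) by (simp add: differentiable_on_eq_differentiable_at)
qed

lemma smooth_on_local:
  assumes "open S" and "\<And>x. x \<in> S \<Longrightarrow> \<exists>U. open U \<and> x \<in> U \<and> smooth_on U f"
  shows "smooth_on S f"
  unfolding smooth_on_def
proof
  fix k show "Ck_on k S f"
    by (rule Ck_on_local[OF assms(1)]) (use assms(2) in \<open>auto simp: smooth_on_def\<close>)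
qed

text \<open>Differentiability of every member gives continuity at stage 0, and the induction step
  only moves within the family. Partial derivatives have to agree with members on \<open>S\<close>
  alone, because rules such as the chain rule are available only there.\<close>

lemma smooth_on_coinduct:
  assumes S: "open S" and f: "F f"
    and diff: "\<And>f x. F f \<Longrightarrow> x \<in> S \<Longrightarrow> f differentiable (at x)"
    and part: "\<And>f i. F f \<Longrightarrow> \<exists>h. F h \<and> (\<forall>x\<in>S. partial i f x = h x)"
  shows "smooth_on S f"
  unfolding smooth_on_def
proof
  fix k show "Ck_on k S f" using f
  proof (induction k arbitrary: f)
    case 0
    then show ?case
      using diff by (auto simp: continuous_on_eq_continuous_at[OF S] intro: differentiable_imp_continuous_within)
  next
    case (Suc k)
    have "Ck_on k S (partial i f)" for i
    proof -
      obtain h where "F h" "\<forall>x\<in>S. partial i f x = h x" using part Suc.prems by blast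
      then show ?thesis using Suc.IH[of h] Ck_on_cong[OF S, of k h "partial i f"] by simp
    qed
    then show ?case using diff Suc.prems by (simp add: differentiable_on_eq_differentiable_at[OF S])
  qed
qed

text \<open>Only \<open>flat 0\<close> is needed; the other \<open>flat m\<close> make the family closed under differentiation.\<close>

definition flat :: "nat \<Rightarrow> real \<Rightarrow> real" where
  "flat m t = (if t > 0 then exp (- inverse t) * inverse t ^ m else 0)"

lemma flat_tendsto_0: "(flat m \<longlongrightarrow> 0) (at 0)"
proof -
  have "((\<lambda>t. inverse t ^ m / exp (inverse t)) \<longlongrightarrow> 0) (at_right (0::real))"
    by (rule filterlim_compose[OF tendsto_power_div_exp_0 filterlim_inverse_at_top_right])
  then have "(flat m \<longlongrightarrow> 0) (at_right 0)"
    by (rule Lim_transform_eventually)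
      (auto simp: eventually_at_filter flat_def exp_minus field_simps)
  moreover have "(flat m \<longlongrightarrow> 0) (at_left 0)"
    by (rule Lim_transform_eventually[OF tendsto_const])
      (auto simp: eventually_at_filter flat_def)
  ultimately show ?thesis by (simp add: filterlim_split_at)
qed

lemma flat_deriv:
  "(flat m has_real_derivative (flat (m + 2) t - real m * flat (m + 1) t)) (at t)"
proof -
  consider "t > 0" | "t < 0" | "t = 0" by linarith
  then show ?thesis
  proof cases
    case 1
    have "((\<lambda>t. exp (- inverse t) * inverse t ^ m) has_real_derivative
        (flat (m + 2) t - real m * flat (m + 1) t)) (at t)"
      \<comment> \<open>The power rule produces the exponent \<open>m - 1\<close>, truncated at
        \<open>m = 0\<close>; hence the final case split.\<close>
      using 1 by (auto intro!: derivative_eq_intros simp: flat_def field_simps power2_eq_square)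
         (cases m; simp add: field_simps)
    then show ?thesis
      by (rule has_field_derivative_transform_within_open[where S = "{0<..}"])
        (use 1 in \<open>auto simp: flat_def\<close>)
  next
    case 2
    have "((\<lambda>t. 0) has_real_derivative (flat (m + 2) t - real m * flat (m + 1) t)) (at t)"
      using 2 by (simp add: flat_def)
    then show ?thesis
      by (rule has_field_derivative_transform_within_open[where S = "{..<0}"])
        (use 2 in \<open>auto simp: flat_def\<close>)
  next
    case 3
    \<comment> \<open>Away from 0 the difference quotient of \<open>flat m\<close> at 0 is
      \<open>flat (Suc m)\<close>.\<close>
    have "((\<lambda>h. (flat m (0 + h) - flat m 0) / h) \<longlongrightarrow> 0) (at 0)"
      by (rule Lim_transform_eventually[OF flat_tendsto_0[of "Suc m"]])
        (auto simp: flat_def field_simps eventually_at_filter)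
    then show ?thesis using 3 by (simp add: DERIV_def flat_def)
  qed
qed

lemma flat_nonneg: "flat m t \<ge> 0"
  by (simp add: flat_def)

lemma flat_pos_iff: "flat m t > 0 \<longleftrightarrow> t > 0"
  by (simp add: flat_def)

lemma flat_0_mono: "s \<le> t \<Longrightarrow> flat 0 s \<le> flat 0 t"
  by (simp add: flat_def)

text \<open>\<open>smooth_gen S\<close> is invariant under partial derivatives, so a single coinduction proves all
  closure properties of smoothness.\<close>

inductive smooth_gen :: "(real^'n::finite) set \<Rightarrow> (real^'n \<Rightarrow> real) \<Rightarrow> bool" for S where
  base: "smooth_on S f \<Longrightarrow> smooth_gen S f"
| const: "smooth_gen S (\<lambda>_. c)"
| add: "smooth_gen S f \<Longrightarrow> smooth_gen S h \<Longrightarrow> smooth_gen S (\<lambda>x. f x + h x)"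
| mult: "smooth_gen S f \<Longrightarrow> smooth_gen S h \<Longrightarrow> smooth_gen S (\<lambda>x. f x * h x)"
| comp: "smooth_on T f \<Longrightarrow> open T \<Longrightarrow> (\<And>j. smooth_on S (\<lambda>x. h x $ j)) \<Longrightarrow> h ` S \<subseteq> T \<Longrightarrow>
    smooth_gen S (\<lambda>x. f (h x :: real^'n))"
| exp: "smooth_gen S f \<Longrightarrow> smooth_gen S (\<lambda>x. exp (f x))"
| flat: "smooth_gen S f \<Longrightarrow> smooth_gen S (\<lambda>x. flat m (f x))"

lemma smooth_gen_sum:
  "finite A \<Longrightarrow> (\<And>a. a \<in> A \<Longrightarrow> smooth_gen S (f a)) \<Longrightarrow> smooth_gen S (\<lambda>x. \<Sum>a\<in>A. f a x)"
  by (induction A rule: finite_induct) (auto intro: smooth_gen.intros)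

lemma smooth_gen_differentiable:
  assumes "open S" "smooth_gen S f" "x \<in> S"
  shows "f differentiable (at x)"
  using assms(2)
proof induction
  case (comp T f h)
  show ?case
    by (rule partial_comp(1)) (use comp assms smooth_on_differentiable in blast)+
next
  case (exp f)
  then show ?case using partial_comp_real(1)[OF DERIV_exp] by blast
next
  case (flat f m)
  then show ?case using partial_comp_real(1)[OF flat_deriv] by blast
qed (use assms in \<open>auto intro: smooth_on_differentiable derivative_intros\<close>)

lemma smooth_gen_partial:
  assumes S: "open S" and "smooth_gen S f"
  shows "\<exists>h. smooth_gen S h \<and> (\<forall>x\<in>S. partial i f x = h x)"
  using assms(2)
proof induction
  case (base f)
  then show ?case by (intro exI[of _ "partial i f"]) (auto intro: smooth_gen.base smooth_on_partial)
next
  case (const c)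
  then show ?case by (intro exI[of _ "\<lambda>_. 0"]) (auto intro: smooth_gen.const)
next
  case (add f h)
  then obtain f' h' where "smooth_gen S f'" "\<forall>x\<in>S. partial i f x = f' x"
     "smooth_gen S h'" "\<forall>x\<in>S. partial i h x = h' x" by blast
  then show ?case using add.hyps smooth_gen_differentiable[OF S]
    by (intro exI[of _ "\<lambda>x. f' x + h' x"]) (auto intro: smooth_gen.add simp: partial_add)
next
  case (mult f h)
  then obtain f' h' where "smooth_gen S f'" "\<forall>x\<in>S. partial i f x = f' x"
     "smooth_gen S h'" "\<forall>x\<in>S. partial i h x = h' x" by blast
  then show ?case using mult.hyps smooth_gen_differentiable[OF S]
    by (intro exI[of _ "\<lambda>x. f' x * h x + f x * h' x"])
      (auto intro: smooth_gen.add smooth_gen.mult simp: partial_mult)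
next
  case (comp T f h)
  \<comment> \<open>The class is not left: \<open>partial j f\<close> is again smooth on
    \<open>T\<close>, so its composite with \<open>h\<close> is another instance of the rule
    \<open>comp\<close>.\<close>
  have "smooth_gen S (\<lambda>x. \<Sum>j\<in>UNIV. partial j f (h x) * partial i (\<lambda>x. h x $ j) x)"
    using comp by (intro smooth_gen_sum smooth_gen.mult smooth_gen.comp[of T "partial j f" for j])
      (auto intro: smooth_on_partial smooth_gen.base)
  moreover have "partial i (\<lambda>x. f (h x)) x = (\<Sum>j\<in>UNIV. partial j f (h x) * partial i (\<lambda>x. h x $ j) x)"
    if "x \<in> S" for x
    by (rule partial_comp(2)) (use comp S that smooth_on_differentiable in blast)+
  ultimately show ?case by blast
next
  case (exp f)
  then obtain f' where "smooth_gen S f'" "\<forall>x\<in>S. partial i f x = f' x" by blast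
  then show ?case using exp.hyps smooth_gen_differentiable[OF S]
    by (intro exI[of _ "\<lambda>x. exp (f x) * f' x"])
      (auto intro: smooth_gen.intros simp: partial_comp_real(2)[OF DERIV_exp])
next
  case (flat f m)
  then obtain f' where "smooth_gen S f'" "\<forall>x\<in>S. partial i f x = f' x" by blast
  then show ?case using flat.hyps smooth_gen_differentiable[OF S]
    by (intro exI[of _ "\<lambda>x. (flat (m + 2) (f x) + (- real m) * flat (m + 1) (f x)) * f' x"]
        conjI smooth_gen.mult smooth_gen.add smooth_gen.const smooth_gen.flat)
      (simp_all add: partial_comp_real(2)[OF flat_deriv])
qed

lemma smooth_gen_smooth:
  assumes "open S" "smooth_gen S f" shows "smooth_on S f"
  using assms smooth_on_coinduct[where F = "smooth_gen S", OF assms]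
    smooth_gen_differentiable smooth_gen_partial by blast

lemma smooth_on_const: "open S \<Longrightarrow> smooth_on S (\<lambda>_. c)"
  by (rule smooth_gen_smooth[OF _ smooth_gen.const])

lemma smooth_on_add: "open S \<Longrightarrow> smooth_on S f \<Longrightarrow> smooth_on S h \<Longrightarrow> smooth_on S (\<lambda>x. f x + h x)"
  by (rule smooth_gen_smooth[OF _ smooth_gen.add[OF smooth_gen.base smooth_gen.base]])

lemma smooth_on_mult: "open S \<Longrightarrow> smooth_on S f \<Longrightarrow> smooth_on S h \<Longrightarrow> smooth_on S (\<lambda>x. f x * h x)"
  by (rule smooth_gen_smooth[OF _ smooth_gen.mult[OF smooth_gen.base smooth_gen.base]])

lemma smooth_on_exp: "open S \<Longrightarrow> smooth_on S f \<Longrightarrow> smooth_on S (\<lambda>x. exp (f x))"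
  by (rule smooth_gen_smooth[OF _ smooth_gen.exp[OF smooth_gen.base]])

lemma smooth_on_comp:
  fixes h :: "real^'n::finite \<Rightarrow> real^'n"
  assumes "open S" "open T" "smooth_on T f" "\<And>j. smooth_on S (\<lambda>x. h x $ j)" "h ` S \<subseteq> T"
  shows "smooth_on S (\<lambda>x. f (h x))"
  using assms by (blast intro: smooth_gen_smooth[OF _ smooth_gen.comp])

lemma smooth_on_linear:
  assumes "open S" "bounded_linear f"
  shows "smooth_on S f"
proof -
  have d: "(f has_derivative f) (at x)" for x
    using assms(2) by (rule bounded_linear_imp_has_derivative)
  show ?thesis
  \<comment> \<open>A linear map has constant partial derivatives, so adding the constants closes
    the family.\<close>
  proof (rule smooth_on_coinduct[where F = "\<lambda>h. h = f \<or> (\<exists>c. h = (\<lambda>_. c))"])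
    fix h i assume "h = f \<or> (\<exists>c. h = (\<lambda>_. c))"
    then show "\<exists>h'. (h' = f \<or> (\<exists>c. h' = (\<lambda>_. c))) \<and> (\<forall>x\<in>S. partial i h x = h' x)"
    proof
      assume "h = f"
      then show ?thesis using partial_unique[OF d, of i]
        by (intro exI[of _ "\<lambda>_. f (axis i 1)"]) auto
    next
      assume "\<exists>c. h = (\<lambda>_. c)"
      then show ?thesis by (intro exI[of _ "\<lambda>_. 0"]) auto
    qed
  qed (use assms d differentiableI in auto)
qed

lemma smooth_on_component: "open S \<Longrightarrow> smooth_on S (\<lambda>x::real^'n::finite. x $ i)"
  by (intro smooth_on_linear bounded_linear_vec_nth)

text \<open>With q the squared distance to \<open>x0\<close>, the function is flat 0 (c - flat 0 (q
  - a)) / flat 0 c. For q < a the inner value is 0, which gives 1; for q \<ge> e^2 = 2 a it is at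
  least flat 0 a = c, so the outer argument is at most 0. The nesting avoids a quotient of two
  functions, for which \<open>smooth_gen\<close> has no rule.\<close>

lemma smooth_cutoff_euclidean:
  fixes x0 :: "real^'n::finite"
  assumes "e > 0"
  obtains f :: "real^'n \<Rightarrow> real" and d where "smooth_on UNIV f" "\<And>x. 0 \<le> f x" "d > 0"
    "\<And>x. dist x0 x < d \<Longrightarrow> f x = 1" "\<And>x. dist x0 x \<ge> e \<Longrightarrow> f x = 0"
proof -
  define a where "a = (e\<^sup>2) / 2"
  define c where "c = flat 0 a"
  define q where "q x = (\<Sum>i\<in>UNIV. (x $ i - x0 $ i) * (x $ i - x0 $ i))" for x :: "real^'n"
  define f where "f x = inverse (flat 0 c) * flat 0 (c + (-1) * flat 0 (q x + (- a)))" for x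
  have a: "a > 0" using assms by (simp add: a_def)
  then have c: "c > 0" by (simp add: c_def flat_pos_iff)
  then have fc: "flat 0 c > 0" by (simp add: flat_pos_iff)
  have q: "q x = (dist x0 x)\<^sup>2" for x
    unfolding q_def dist_vec_def L2_set_def
    by (subst real_sqrt_pow2)
      (auto intro!: sum_nonneg sum.cong simp: dist_real_def power2_commute simp flip: power2_eq_square)
  have comp: "smooth_gen UNIV (\<lambda>x::real^'n. x $ i + (- x0 $ i))" for i
    by (intro smooth_gen.add smooth_gen.base smooth_on_component smooth_gen.const open_UNIV)
  then have "smooth_gen UNIV q"
    unfolding q_def[abs_def] by (intro smooth_gen_sum smooth_gen.mult) auto
  then have "smooth_on UNIV f"
    unfolding f_def[abs_def]
    by (intro smooth_gen_smooth open_UNIV smooth_gen.mult smooth_gen.add smooth_gen.const smooth_gen.flat)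
  moreover have "0 \<le> f x" for x using fc by (simp add: f_def flat_nonneg)
  moreover have "sqrt a > 0" using a by simp
  moreover have "f x = 1" if "dist x0 x < sqrt a" for x
  proof -
    have "q x < a" unfolding q using that a by (metis sqrt_le_D not_less real_sqrt_ge_zero real_sqrt_pow2 abs_of_nonneg real_less_rsqrt zero_le_dist power2_eq_square real_sqrt_less_iff real_sqrt_abs)
    then have "flat 0 (q x + (- a)) = 0" by (simp add: flat_def)
    then show ?thesis using fc by (simp add: f_def)
  qed
  moreover have "f x = 0" if "dist x0 x \<ge> e" for x
  proof -
    have "q x \<ge> e\<^sup>2" unfolding q using that assms by (simp add: power_mono)
    then have "flat 0 (q x + (- a)) \<ge> c" unfolding c_def by (intro flat_0_mono) (simp add: a_def)
    then show ?thesis by (simp add: f_def flat_def)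
  qed
  ultimately show ?thesis using that by blast
qed

subsection \<open>Smooth functions and diffeomorphisms\<close>

lemma topological_chartD:
  assumes "topological_chart X c"
  shows "openin X (cdom c)" "open (cimage c)" "cdom c \<subseteq> topspace X" "inj_on (snd c) (cdom c)"
proof -
  show *: "openin X (cdom c)" "open (cimage c)" using assms by (auto simp: topological_chart_def)
  then show sub: "cdom c \<subseteq> topspace X" by (simp add: openin_subset)
  then show "inj_on (snd c) (cdom c)"
    using assms homeomorphic_imp_injective_map[of "subtopology X (cdom c)" "top_of_set (cimage c)" "snd c"]
    by (simp add: topological_chart_def Int_absorb1)
qed

lemma cinv_left: "topological_chart X c \<Longrightarrow> p \<in> cdom c \<Longrightarrow> cinv c (snd c p) = p"
  by (simp add: cinv_def topological_chartD(4))

lemma cinv_right: "x \<in> cimage c \<Longrightarrow> snd c (cinv c x) = x"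
  unfolding cinv_def by (rule f_inv_into_f)

lemma cinv_in: "x \<in> cimage c \<Longrightarrow> cinv c x \<in> cdom c"
  unfolding cinv_def by (rule inv_into_into)

lemma chart_image_open:
  assumes "topological_chart X c" "openin X U"
  shows "open (snd c ` (cdom c \<inter> U))"
proof -
  have "open_map (subtopology X (cdom c)) (top_of_set (cimage c)) (snd c)"
    using assms by (auto simp: topological_chart_def intro: homeomorphic_imp_open_map)
  moreover have "openin (subtopology X (cdom c)) (cdom c \<inter> U)"
    using assms topological_chartD(1)[OF assms(1)] by (simp add: openin_open_subtopology openin_Int)
  ultimately have "openin (top_of_set (cimage c)) (snd c ` (cdom c \<inter> U))"
    by (simp add: open_map_def)
  then show ?thesis using topological_chartD(2)[OF assms(1)] by (simp add: openin_open_eq)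
qed

lemma chart_vimage_open:
  assumes "topological_chart X c" "open W"
  shows "openin X {p \<in> cdom c. snd c p \<in> W}"
proof -
  have "continuous_map (subtopology X (cdom c)) (top_of_set (cimage c)) (snd c)"
    using assms by (auto simp: topological_chart_def intro: homeomorphic_imp_continuous_map)
  then have "continuous_map (subtopology X (cdom c)) euclidean (snd c)"
    by (simp add: continuous_map_in_subtopology)
  then have "openin (subtopology X (cdom c)) {p \<in> topspace (subtopology X (cdom c)). snd c p \<in> W}"
    using assms(2) by (auto simp: continuous_map_def)
  moreover have "{p \<in> topspace (subtopology X (cdom c)). snd c p \<in> W} = {p \<in> cdom c. snd c p \<in> W}"
    using topological_chartD(3)[OF assms(1)] by auto
  ultimately show ?thesis using topological_chartD(1)[OF assms(1)]
    by (simp add: openin_open_subtopology)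
qed

lemma chart_vimage_compact:
  assumes "topological_chart X c" "compact K" "K \<subseteq> cimage c"
  shows "compactin X {p \<in> cdom c. snd c p \<in> K}"
proof -
  let ?L = "{p \<in> cdom c. snd c p \<in> K}"
  have img: "snd c ` ?L = K" using assms(3) by auto
  have hom: "homeomorphic_map (subtopology X (cdom c)) (top_of_set (cimage c)) (snd c)"
    using assms(1) by (simp add: topological_chart_def)
  have "compactin (top_of_set (cimage c)) (snd c ` ?L)"
    using assms(2,3) img by (simp add: compactin_subtopology)
  then have "compactin (subtopology X (cdom c)) ?L"
    using homeomorphic_map_compactness[OF hom, of ?L] topological_chartD(3)[OF assms(1)]
    by (auto simp: topspace_subtopology_subset)
  then show ?thesis by (simp add: compactin_subtopology)
qed

section \<open>Smooth functions on open sets, and bump functions\<close>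

lemma C_inf_zero_off: "u \<in> C_inf M \<Longrightarrow> p \<notin> points M \<Longrightarrow> u p = 0"
  by (simp add: C_inf_def)

text \<open>Chart components are smooth only on part of the manifold and need not vanish elsewhere,
  so \<open>C_inf\<close> does not cover them. Values of \<open>u\<close> off \<open>U\<close> do
  not enter.\<close>

definition smooth_fun :: "('a, 'n::finite) manifold \<Rightarrow> 'a set \<Rightarrow> ('a \<Rightarrow> real) \<Rightarrow> bool" where
  "smooth_fun M U u \<longleftrightarrow> (\<forall>c\<in>atlas M. smooth_on (snd c ` (cdom c \<inter> U)) (\<lambda>x. u (cinv c x)))"

locale smooth_mfd =
  fixes M :: "('a, 'n::finite) manifold"
  assumes smooth_mfd: "smooth_manifold M"
begin

lemma atlas_chart: "c \<in> atlas M \<Longrightarrow> topological_chart (mtop M) c"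
  using smooth_mfd by (simp add: smooth_manifold_def)

lemmas chartD = topological_chartD[OF atlas_chart]
lemmas atlas_cinv_left = cinv_left[OF atlas_chart]
lemmas atlas_image_open = chart_image_open[OF atlas_chart]
lemmas atlas_vimage_open = chart_vimage_open[OF atlas_chart]

lemma points_chart:
  assumes "p \<in> points M" obtains c where "c \<in> atlas M" "p \<in> cdom c"
  using assms smooth_mfd unfolding smooth_manifold_def by blast

lemma atlas_maximal:
  "topological_chart (mtop M) c \<Longrightarrow> (\<And>d. d \<in> atlas M \<Longrightarrow> compatible c d) \<Longrightarrow> c \<in> atlas M"
  using smooth_mfd unfolding smooth_manifold_def by blast

lemma atlas_transition:
  "c \<in> atlas M \<Longrightarrow> d \<in> atlas M \<Longrightarrow> smooth_on (snd c ` (cdom c \<inter> cdom d)) (\<lambda>x. snd d (cinv c x) $ i)"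
  using smooth_mfd unfolding smooth_manifold_def compatible_def smooth_transition_def by blast

text \<open>One chart suffices, because the transition maps of the atlas carry smoothness in
  \<open>c\<close> to every other chart.\<close>

lemma smooth_fun_chart:
  assumes c: "c \<in> atlas M" and U: "openin (mtop M) U" "U \<subseteq> cdom c"
    and u: "smooth_on (snd c ` U) (\<lambda>x. u (cinv c x))"
  shows "smooth_fun M U u"
  unfolding smooth_fun_def
proof
  fix d assume d: "d \<in> atlas M"
  let ?S = "snd d ` (cdom d \<inter> U)"
  have S: "open ?S" using atlas_image_open[OF d U(1)] .
  have "cdom c \<inter> U = U" using U(2) by blast
  then have T: "open (snd c ` U)" using atlas_image_open[OF c U(1)] by simp
  have "?S \<subseteq> snd d ` (cdom d \<inter> cdom c)" using U(2) by auto
  then have "smooth_on ?S (\<lambda>x. snd c (cinv d x) $ i)" for i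
    using atlas_transition[OF d c] smooth_on_subset by blast
  moreover have "(\<lambda>x. snd c (cinv d x)) ` ?S \<subseteq> snd c ` U"
    using atlas_cinv_left[OF d] by auto
  ultimately have "smooth_on ?S (\<lambda>x. u (cinv c (snd c (cinv d x))))"
    by (rule smooth_on_comp[OF S T u])
  then show "smooth_on ?S (\<lambda>x. u (cinv d x))"
    by (rule smooth_on_cong[OF S]) (use U(2) in \<open>auto simp: atlas_cinv_left[OF d] atlas_cinv_left[OF c]\<close>)
qed

lemma smooth_fun_local:
  assumes U: "openin (mtop M) U"
    and loc: "\<And>p. p \<in> U \<Longrightarrow> \<exists>V. openin (mtop M) V \<and> p \<in> V \<and> smooth_fun M V u"
  shows "smooth_fun M U u"
  unfolding smooth_fun_def
proof
  fix c assume c: "c \<in> atlas M"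
  show "smooth_on (snd c ` (cdom c \<inter> U)) (\<lambda>x. u (cinv c x))"
  proof (rule smooth_on_local[OF atlas_image_open[OF c U]])
    fix x assume "x \<in> snd c ` (cdom c \<inter> U)"
    then obtain p where p: "p \<in> cdom c" "p \<in> U" "x = snd c p" by blast
    obtain V where "openin (mtop M) V" "p \<in> V" "smooth_fun M V u" using loc p by blast
    then show "\<exists>V. open V \<and> x \<in> V \<and> smooth_on V (\<lambda>x. u (cinv c x))"
      using p c atlas_image_open[OF c] by (intro exI[of _ "snd c ` (cdom c \<inter> V)"]) (auto simp: smooth_fun_def)
  qed
qed

lemma smooth_fun_mono: "smooth_fun M V u \<Longrightarrow> U \<subseteq> V \<Longrightarrow> smooth_fun M U u"
  unfolding smooth_fun_def by (meson Int_mono image_mono order_refl smooth_on_subset)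

lemma smooth_fun_cong:
  assumes "openin (mtop M) U" "smooth_fun M U u" "\<And>p. p \<in> U \<Longrightarrow> u p = v p"
  shows "smooth_fun M U v"
  unfolding smooth_fun_def
proof
  fix c assume c: "c \<in> atlas M"
  have "smooth_on (snd c ` (cdom c \<inter> U)) (\<lambda>x. u (cinv c x))"
    using assms(2) c by (simp add: smooth_fun_def)
  then show "smooth_on (snd c ` (cdom c \<inter> U)) (\<lambda>x. v (cinv c x))"
    by (rule smooth_on_cong[OF atlas_image_open[OF c assms(1)]])
      (use assms(3) in \<open>auto simp: atlas_cinv_left[OF c]\<close>)
qed

lemma smooth_fun_intros:
  assumes "openin (mtop M) U"
  shows "smooth_fun M U (\<lambda>_. a)"
    and "smooth_fun M U u \<Longrightarrow> smooth_fun M U v \<Longrightarrow> smooth_fun M U (\<lambda>p. u p + v p)"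
    and "smooth_fun M U u \<Longrightarrow> smooth_fun M U v \<Longrightarrow> smooth_fun M U (\<lambda>p. u p * v p)"
    and "smooth_fun M U u \<Longrightarrow> smooth_fun M U (\<lambda>p. exp (u p))"
  using atlas_image_open[OF _ assms] unfolding smooth_fun_def
  by (auto intro!: smooth_on_const smooth_on_add smooth_on_mult smooth_on_exp)

lemma smooth_fun_component:
  assumes "c \<in> atlas M"
  shows "smooth_fun M (cdom c) (\<lambda>p. snd c p $ i)"
proof (rule smooth_fun_chart[OF assms])
  have "smooth_on (cimage c) (\<lambda>x. x $ i)"
    by (rule smooth_on_component) (use chartD(2)[OF assms] in auto)
  then show "smooth_on (cimage c) (\<lambda>x. snd c (cinv c x) $ i)"
    by (rule smooth_on_cong[OF chartD(2)[OF assms]]) (simp add: cinv_right)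
qed (use chartD[OF assms] in auto)

lemma C_inf_iff:
  "u \<in> C_inf M \<longleftrightarrow> (\<forall>p. p \<notin> points M \<longrightarrow> u p = 0) \<and> smooth_fun M (points M) u"
proof -
  have "cdom c \<inter> points M = cdom c" if "c \<in> atlas M" for c using chartD(3)[OF that] by blast
  then show ?thesis by (simp add: C_inf_def smooth_fun_def)
qed

lemma C_inf_smooth_fun: "u \<in> C_inf M \<Longrightarrow> smooth_fun M U u"
  unfolding smooth_fun_def C_inf_def
  by (metis (no_types, lifting) Int_lower1 image_mono mem_Collect_eq smooth_on_subset)

lemma C_inf_chart: "u \<in> C_inf M \<Longrightarrow> c \<in> atlas M \<Longrightarrow> smooth_on (cimage c) (\<lambda>x. u (cinv c x))"
  by (simp add: C_inf_def)

lemma C_inf_const: "(\<lambda>p. if p \<in> points M then a else 0) \<in> C_inf M"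
  unfolding C_inf_iff
  by (auto intro: smooth_fun_cong[OF openin_topspace smooth_fun_intros(1)[OF openin_topspace]])

lemma C_inf_scale: "u \<in> C_inf M \<Longrightarrow> (\<lambda>p. a * u p) \<in> C_inf M"
  unfolding C_inf_iff by (auto intro!: smooth_fun_intros[OF openin_topspace])

lemma C_inf_lincomb:
  "u \<in> C_inf M \<Longrightarrow> v \<in> C_inf M \<Longrightarrow> (\<lambda>p. a * u p + b * v p) \<in> C_inf M"
  unfolding C_inf_iff by (auto intro!: smooth_fun_intros[OF openin_topspace])

lemma C_inf_mult: "u \<in> C_inf M \<Longrightarrow> v \<in> C_inf M \<Longrightarrow> (\<lambda>p. u p * v p) \<in> C_inf M"
  unfolding C_inf_iff by (auto intro!: smooth_fun_intros[OF openin_topspace])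

lemma C_inf_exp_mult: "\<Upsilon> \<in> C_inf M \<Longrightarrow> u \<in> C_inf M \<Longrightarrow> exp_mult s \<Upsilon> u \<in> C_inf M"
  unfolding C_inf_iff exp_mult_def by (auto intro!: smooth_fun_intros[OF openin_topspace])

lemma C_inf_compact_mult:
  "u \<in> C_inf_compact M \<Longrightarrow> v \<in> C_inf M \<Longrightarrow> (\<lambda>p. u p * v p) \<in> C_inf_compact M"
  unfolding C_inf_compact_def using C_inf_mult by fastforce

lemma C_inf_continuous:
  assumes "u \<in> C_inf M" shows "continuous_map (mtop M) euclidean u"
  unfolding continuous_map_def
proof (intro conjI allI impI)
  fix W :: "real set" assume "openin euclidean W"
  then have W: "open W" by simp
  have "{p \<in> points M. u p \<in> W} = (\<Union>c\<in>atlas M. {p \<in> cdom c. snd c p \<in> {x \<in> cimage c. u (cinv c x) \<in> W}})"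
    (is "?L = ?R")
  proof (intro equalityI subsetI)
    fix p assume p: "p \<in> ?L"
    then obtain c where "c \<in> atlas M" "p \<in> cdom c" using points_chart by blast
    then show "p \<in> ?R" using p by (intro UN_I[of c]) (auto simp: atlas_cinv_left)
  next
    fix p assume "p \<in> ?R"
    then obtain c where c: "c \<in> atlas M" "p \<in> cdom c" "u (cinv c (snd c p)) \<in> W" by blast
    then show "p \<in> ?L" using chartD(3)[OF c(1)] by (auto simp: atlas_cinv_left)
  qed
  moreover have "openin (mtop M) {p \<in> cdom c. snd c p \<in> {x \<in> cimage c. u (cinv c x) \<in> W}}"
    if c: "c \<in> atlas M" for c
  proof (rule atlas_vimage_open[OF c])
    have "open (cimage c \<inter> (\<lambda>x. u (cinv c x)) -` W)"
      using smooth_on_continuous[OF C_inf_chart[OF assms c]] chartD(2)[OF c] W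
      by (rule continuous_open_preimage)
    then show "open {x \<in> cimage c. u (cinv c x) \<in> W}" by (simp add: vimage_def Int_def)
  qed
  ultimately show "openin (mtop M) {p \<in> points M. u p \<in> W}" by auto
qed auto

text \<open>A Euclidean bump read in the chart and extended by zero. The closed ball keeps the
  support compact inside the chart, which later bounds integrals; the plateau \<open>V\<close>
  serves locality arguments; the last property extends by zero, after multiplication, a function
  known to be smooth on \<open>U\<close> only.\<close>

lemma cutoff:
  assumes c: "c \<in> atlas M" and U: "openin (mtop M) U" "U \<subseteq> cdom c" "p \<in> U"
  obtains \<phi> e V where "\<phi> \<in> C_inf_compact M" "\<And>q. 0 \<le> \<phi> q" "e > 0"
    "cball (snd c p) e \<subseteq> snd c ` U" "\<And>q. \<phi> q \<noteq> 0 \<Longrightarrow> q \<in> cdom c \<and> snd c q \<in> cball (snd c p) e"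
    "openin (mtop M) V" "p \<in> V" "V \<subseteq> U" "\<And>q. q \<in> V \<Longrightarrow> \<phi> q = 1"
    "\<And>u. smooth_fun M U u \<Longrightarrow> (\<lambda>q. \<phi> q * u q) \<in> C_inf M"
proof -
  let ?x = "snd c p"
  have cU: "cdom c \<inter> U = U" using U by blast
  have "open (snd c ` U)" using atlas_image_open[OF c U(1)] cU by simp
  then obtain e where e: "e > 0" "cball ?x e \<subseteq> snd c ` U"
    using U(3) open_contains_cball by blast
  obtain f d where f: "smooth_on UNIV f" "\<And>x. 0 \<le> f x" "d > 0"
    "\<And>x. dist ?x x < d \<Longrightarrow> f x = (1::real)" "\<And>x. dist ?x x \<ge> e \<Longrightarrow> f x = 0"
    using smooth_cutoff_euclidean[OF e(1)] by blast
  define \<phi> where "\<phi> q = (if q \<in> cdom c then f (snd c q) else 0)" for q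
  define K where "K = {q \<in> cdom c. snd c q \<in> cball ?x e}"
  have supp: "q \<in> K" if "\<phi> q \<noteq> 0" for q
    using that f(5)[of "snd c q"] unfolding K_def \<phi>_def by (auto split: if_splits) (meson linear)
  have Kc: "compactin (mtop M) K"
    unfolding K_def using e(2) U(2) by (intro chart_vimage_compact[OF atlas_chart[OF c]]) auto
  \<comment> \<open>The Hausdorff property makes \<open>K\<close> closed, so its complement is an
    open set on which \<phi> vanishes; it contains all points outside the chart.\<close>
  then have Kcl: "closedin (mtop M) K"
    using smooth_mfd by (simp add: smooth_manifold_def compactin_imp_closedin)
  have "smooth_fun M (points M) \<phi>"
  proof (rule smooth_fun_local[OF openin_topspace])
    fix q assume q: "q \<in> points M"
    show "\<exists>V. openin (mtop M) V \<and> q \<in> V \<and> smooth_fun M V \<phi>"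
    proof (cases "q \<in> cdom c")
      case True
      have "smooth_on (cimage c) f" using f(1) smooth_on_subset by blast
      then have "smooth_on (cimage c) (\<lambda>x. \<phi> (cinv c x))"
        by (rule smooth_on_cong[OF chartD(2)[OF c]]) (simp add: \<phi>_def cinv_right cinv_in)
      then show ?thesis using True chartD(1)[OF c] smooth_fun_chart[OF c] by blast
    next
      case False
      let ?V = "points M - K"
      have V: "openin (mtop M) ?V" using Kcl by blast
      moreover have "q \<in> ?V" using q False by (simp add: K_def)
      moreover have "smooth_fun M ?V \<phi>"
        by (rule smooth_fun_cong[OF V smooth_fun_intros(1)[OF V, of 0]]) (use supp in fastforce)
      ultimately show ?thesis by blast
    qed
  qed
  then have "\<phi> \<in> C_inf M" using chartD(3)[OF c] by (auto simp: C_inf_iff \<phi>_def)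
  then have 1: "\<phi> \<in> C_inf_compact M" using Kc supp by (auto simp: C_inf_compact_def)
  \<comment> \<open>Radius \<open>d\<close> gives the value 1; radius \<open>e\<close> keeps
    \<open>V\<close> inside \<open>K\<close> and therefore inside \<open>U\<close>.\<close>
  define V where "V = {q \<in> cdom c. snd c q \<in> ball ?x (min d e)}"
  have V: "openin (mtop M) V" unfolding V_def by (rule atlas_vimage_open[OF c]) simp
  have KU: "K \<subseteq> U"
  proof
    fix q assume q: "q \<in> K"
    then have "snd c q \<in> snd c ` U" using e(2) by (auto simp: K_def)
    then show "q \<in> U" using q U(2) chartD(4)[OF c] by (auto simp: K_def inj_on_def)
  qed
  moreover have "V \<subseteq> K" by (auto simp: V_def K_def)
  ultimately have "V \<subseteq> U" by blast
  have mult: "(\<lambda>q. \<phi> q * u q) \<in> C_inf M" if u: "smooth_fun M U u" for u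
    unfolding C_inf_iff
  proof (intro conjI smooth_fun_local[OF openin_topspace])
    show "\<forall>q. q \<notin> points M \<longrightarrow> \<phi> q * u q = 0"
      using chartD(3)[OF c] by (auto simp: \<phi>_def)
    fix q assume q: "q \<in> points M"
    show "\<exists>V. openin (mtop M) V \<and> q \<in> V \<and> smooth_fun M V (\<lambda>q. \<phi> q * u q)"
    proof (cases "q \<in> U")
      case True
      then show ?thesis
        using U(1) smooth_fun_intros(3)[OF U(1) C_inf_smooth_fun[OF \<open>\<phi> \<in> C_inf M\<close>] u] by blast
    next
      case False
      let ?V = "points M - K"
      have V: "openin (mtop M) ?V" using Kcl by blast
      moreover have "q \<in> ?V" using q False KU by blast
      moreover have "smooth_fun M ?V (\<lambda>q. \<phi> q * u q)"
        by (rule smooth_fun_cong[OF V smooth_fun_intros(1)[OF V, of 0]]) (use supp in fastforce)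
      ultimately show ?thesis by blast
    qed
  qed
  show ?thesis
  proof (rule that[OF 1])
    show "0 \<le> \<phi> q" for q using f(2) by (simp add: \<phi>_def)
    show "\<phi> q \<noteq> 0 \<Longrightarrow> q \<in> cdom c \<and> snd c q \<in> cball (snd c p) e" for q
      using supp by (simp add: K_def)
    show "p \<in> V" using U e(1) f(3) by (auto simp: V_def)
    show "\<phi> q = 1" if "q \<in> V" for q using that f(4) by (auto simp: V_def \<phi>_def)
    show "(\<lambda>q. \<phi> q * u q) \<in> C_inf M" if "smooth_fun M U u" for u using that by (rule mult)
  qed fact+
qed

section \<open>Smooth maps and diffeomorphisms\<close>

lemma smooth_map_iff:
  "smooth_map M M F \<longleftrightarrow> continuous_map (mtop M) (mtop M) F \<and>
     (\<forall>d\<in>atlas M. \<forall>i. smooth_fun M {p \<in> points M. F p \<in> cdom d} (\<lambda>p. snd d (F p) $ i))"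
proof -
  have eq: "cdom c \<inter> {p \<in> points M. F p \<in> cdom d} = {p \<in> cdom c. F p \<in> cdom d}" if "c \<in> atlas M" for c d
    using chartD(3)[OF that] by blast
  have "smooth_fun M {p \<in> points M. F p \<in> cdom d} u \<longleftrightarrow>
      (\<forall>c\<in>atlas M. smooth_on (snd c ` {p \<in> cdom c. F p \<in> cdom d}) (\<lambda>x. u (cinv c x)))" for d u
    unfolding smooth_fun_def by (rule ball_cong[OF refl]) (simp only: eq)
  note eq2 = this
  show ?thesis unfolding smooth_map_def eq2 by blast
qed

lemma smooth_fun_compose:
  assumes F: "smooth_map M M F" and V: "openin (mtop M) V" and u: "smooth_fun M V u"
  shows "smooth_fun M {p \<in> points M. F p \<in> V} (\<lambda>p. u (F p))"
proof -
  have cont: "openin (mtop M) {p \<in> points M. F p \<in> W}" if "openin (mtop M) W" for W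
    using F that by (auto simp: smooth_map_def continuous_map_def)
  show ?thesis
  proof (rule smooth_fun_local[OF cont[OF V]])
    fix p assume p: "p \<in> {p \<in> points M. F p \<in> V}"
    then have "F p \<in> points M" using V openin_subset by blast
    then obtain d where d: "d \<in> atlas M" "F p \<in> cdom d" by (rule points_chart)
    obtain c where c: "c \<in> atlas M" "p \<in> cdom c" using p points_chart by blast
    \<comment> \<open>Landing in \<open>cdom d\<close> makes the coordinates of \<open>F\<close>
      available; landing in \<open>V\<close> puts them where \<open>u\<close> is smooth.\<close>
    define W where "W = {p \<in> points M. F p \<in> cdom d \<inter> V}"
    have W: "openin (mtop M) W"
      unfolding W_def by (rule cont) (use V chartD(1)[OF d(1)] in blast)
    define S where "S = snd c ` (cdom c \<inter> W)"
    have S: "open S" unfolding S_def by (rule atlas_image_open[OF c(1) W])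
    have cW: "openin (mtop M) (cdom c \<inter> W)" using W chartD(1)[OF c(1)] by blast
    have "smooth_fun M {p \<in> points M. F p \<in> cdom d} (\<lambda>p. snd d (F p) $ i)" for i
      using F d(1) by (simp add: smooth_map_iff)
    then have "smooth_fun M W (\<lambda>p. snd d (F p) $ i)" for i
      by (rule smooth_fun_mono) (auto simp: W_def)
    then have comps: "smooth_on S (\<lambda>x. snd d (F (cinv c x)) $ i)" for i
      using c(1) unfolding S_def smooth_fun_def by blast
    have u': "smooth_on (snd d ` (cdom d \<inter> V)) (\<lambda>x. u (cinv d x))"
      using u d(1) by (simp add: smooth_fun_def)
    have "(\<lambda>x. snd d (F (cinv c x))) ` S \<subseteq> snd d ` (cdom d \<inter> V)"
      by (auto simp: S_def atlas_cinv_left[OF c(1)] W_def)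
    from smooth_on_comp[OF S atlas_image_open[OF d(1) V] u' comps this]
    have "smooth_on S (\<lambda>x. u (cinv d (snd d (F (cinv c x)))))" .
    then have "smooth_on S (\<lambda>x. u (F (cinv c x)))"
      by (rule smooth_on_cong[OF S])
        (auto simp: S_def W_def atlas_cinv_left[OF c(1)] atlas_cinv_left[OF d(1)])
    then have "smooth_fun M (cdom c \<inter> W) (\<lambda>p. u (F p))"
      unfolding S_def by (intro smooth_fun_chart[OF c(1) cW]) auto
    then show "\<exists>W. openin (mtop M) W \<and> p \<in> W \<and> smooth_fun M W (\<lambda>p. u (F p))"
      using cW p c d unfolding W_def by blast
  qed
qed

lemma smooth_map_compose:
  assumes F: "smooth_map M M F" and G: "smooth_map M M G"
  shows "smooth_map M M (compose (points M) F G)"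
  unfolding smooth_map_iff
proof (intro conjI ballI allI)
  have "continuous_map (mtop M) (mtop M) (F \<circ> G)"
    using F G continuous_map_compose unfolding smooth_map_def by blast
  then show "continuous_map (mtop M) (mtop M) (compose (points M) F G)"
    by (rule continuous_map_eq) (simp add: compose_def)
  fix d i assume d: "d \<in> atlas M"
  let ?U = "{p \<in> points M. F p \<in> cdom d}"
  have U: "openin (mtop M) ?U"
    using F chartD(1)[OF d] by (auto simp: smooth_map_def continuous_map_def)
  have Gm: "G p \<in> points M" if "p \<in> points M" for p
    using G that by (auto simp: smooth_map_def continuous_map_def)
  have "smooth_fun M ?U (\<lambda>p. snd d (F p) $ i)" using F d by (simp add: smooth_map_iff)
  from smooth_fun_compose[OF G U this]
  have *: "smooth_fun M {p \<in> points M. G p \<in> ?U} (\<lambda>p. snd d (F (G p)) $ i)" .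
  have "openin (mtop M) {p \<in> points M. G p \<in> ?U}"
    using G U by (auto simp: smooth_map_def continuous_map_def)
  from smooth_fun_cong[OF this *, of "\<lambda>p. snd d (compose (points M) F G p) $ i"]
  have "smooth_fun M {p \<in> points M. G p \<in> ?U} (\<lambda>p. snd d (compose (points M) F G p) $ i)"
    by (simp add: compose_def)
  moreover have "{p \<in> points M. G p \<in> ?U} = {p \<in> points M. compose (points M) F G p \<in> cdom d}"
    using Gm by (auto simp: compose_def)
  ultimately show "smooth_fun M {p \<in> points M. compose (points M) F G p \<in> cdom d}
     (\<lambda>p. snd d (compose (points M) F G p) $ i)" by simp
qed

lemma smooth_map_id: "smooth_map M M (\<lambda>p\<in>points M. p)"
  unfolding smooth_map_iff
proof (intro conjI ballI allI)
  show "continuous_map (mtop M) (mtop M) (\<lambda>p\<in>points M. p)"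
    by (rule continuous_map_eq[OF continuous_map_id]) simp
  fix d i assume d: "d \<in> atlas M"
  have "{p \<in> points M. (\<lambda>p\<in>points M. p) p \<in> cdom d} = cdom d" using chartD(3)[OF d] by auto
  moreover have "smooth_fun M (cdom d) (\<lambda>p. snd d ((\<lambda>p\<in>points M. p) p) $ i)"
    by (rule smooth_fun_cong[OF chartD(1)[OF d] smooth_fun_component[OF d]])
      (use chartD(3)[OF d] in auto)
  ultimately show "smooth_fun M {p \<in> points M. (\<lambda>p\<in>points M. p) p \<in> cdom d}
     (\<lambda>p. snd d ((\<lambda>p\<in>points M. p) p) $ i)" by simp
qed

lemma pullback_C_inf:
  assumes F: "smooth_map M M F" and u: "u \<in> C_inf M"
  shows "pullback M F u \<in> C_inf M"
  unfolding C_inf_iff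
proof
  have "F p \<in> points M" if "p \<in> points M" for p
    using F that by (auto simp: smooth_map_def continuous_map_def)
  then have "{p \<in> points M. F p \<in> points M} = points M" by auto
  with smooth_fun_compose[OF F openin_topspace C_inf_smooth_fun[OF u]]
  have "smooth_fun M (points M) (\<lambda>p. u (F p))" by simp
  then show "smooth_fun M (points M) (pullback M F u)"
    by (rule smooth_fun_cong[OF openin_topspace]) (simp add: pullback_def)
qed (simp add: pullback_def)

definition dinv :: "('a \<Rightarrow> 'a) \<Rightarrow> 'a \<Rightarrow> 'a" where
  "dinv F = restrict (inv_into (points M) F) (points M)"

lemma diffeosD:
  assumes "F \<in> diffeos M"
  shows "F \<in> Bij (points M)" "smooth_map M M F" "smooth_map M M (dinv F)"
    "\<And>p. p \<in> points M \<Longrightarrow> F p \<in> points M"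
    "\<And>p. p \<in> points M \<Longrightarrow> dinv F p \<in> points M"
    "\<And>p. p \<in> points M \<Longrightarrow> dinv F (F p) = p"
    "\<And>p. p \<in> points M \<Longrightarrow> F (dinv F p) = p"
    "inj_on F (points M)" "F ` points M = points M"
proof -
  show B: "F \<in> Bij (points M)" "smooth_map M M F" "smooth_map M M (dinv F)"
    using assms by (auto simp: diffeos_def dinv_def)
  then have b: "bij_betw F (points M) (points M)" by (simp add: Bij_def)
  then show inj: "inj_on F (points M)" and im: "F ` points M = points M" by (auto simp: bij_betw_def)
  then show FM: "F p \<in> points M" if "p \<in> points M" for p using that by blast
  show "dinv F p \<in> points M" if "p \<in> points M" for p
    using that im by (auto simp: dinv_def intro: inv_into_into)
  show "dinv F (F p) = p" if "p \<in> points M" for p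
    using that FM[OF that] inj by (simp add: dinv_def)
  show "F (dinv F p) = p" if "p \<in> points M" for p
    using that im by (simp add: dinv_def f_inv_into_f)
qed

lemma Bij_eqI:
  "F \<in> Bij S \<Longrightarrow> G \<in> Bij S \<Longrightarrow> (\<And>p. p \<in> S \<Longrightarrow> F p = G p) \<Longrightarrow> F = G"
  by (rule extensionalityI[of _ S]) (auto dest: Bij_imp_extensional)

text \<open>Naming a left inverse \<open>G\<close> identifies \<open>dinv F\<close>, so smoothness
  of the inverse can be proved for an explicit map.\<close>

lemma diffeosI:
  assumes F: "F \<in> Bij (points M)" and G: "G \<in> Bij (points M)"
    and inv: "\<And>p. p \<in> points M \<Longrightarrow> G (F p) = p" and "smooth_map M M F" "smooth_map M M G"
  shows "F \<in> diffeos M" "dinv F = G"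
proof -
  have b: "bij_betw F (points M) (points M)" using F by (simp add: Bij_def)
  show "dinv F = G"
  proof (rule Bij_eqI[OF _ G])
    show "dinv F \<in> Bij (points M)" unfolding dinv_def using F by (rule restrict_inv_into_Bij)
    fix p assume "p \<in> points M"
    then obtain q where q: "q \<in> points M" "p = F q" using b by (auto simp: bij_betw_def)
    then show "dinv F p = G p" using inv b \<open>p \<in> points M\<close> by (simp add: dinv_def bij_betw_def)
  qed
  then show "F \<in> diffeos M" using assms by (auto simp: diffeos_def dinv_def)
qed

lemma diffeos_id: "(\<lambda>p\<in>points M. p) \<in> diffeos M"
  by (rule diffeosI(1)[OF id_Bij id_Bij _ smooth_map_id smooth_map_id]) simp

lemma diffeos_dinv:
  assumes "F \<in> diffeos M" shows "dinv F \<in> diffeos M"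
proof (rule diffeosI(1))
  show "dinv F \<in> Bij (points M)" unfolding dinv_def using diffeosD(1)[OF assms] by (rule restrict_inv_into_Bij)
qed (use diffeosD[OF assms] in auto)

lemma diffeos_compose:
  assumes "F \<in> diffeos M" "G \<in> diffeos M"
  shows "compose (points M) F G \<in> diffeos M"
proof (rule diffeosI(1))
  show "compose (points M) F G \<in> Bij (points M)"
    "compose (points M) (dinv G) (dinv F) \<in> Bij (points M)"
    by (intro compose_Bij diffeosD(1) diffeos_dinv assms)+
  show "smooth_map M M (compose (points M) F G)"
    "smooth_map M M (compose (points M) (dinv G) (dinv F))"
    by (intro smooth_map_compose diffeosD(2,3) assms)+
  fix p assume "p \<in> points M"
  then show "compose (points M) (dinv G) (dinv F) (compose (points M) F G p) = p"
    using diffeosD(4,6)[OF assms(1)] diffeosD(4,6)[OF assms(2)] by (simp add: compose_def)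
qed

section \<open>Charts transported by a diffeomorphism\<close>

definition chart_pull :: "('a \<Rightarrow> 'a) \<Rightarrow> ('a, 'n) chart \<Rightarrow> ('a, 'n) chart" where
  "chart_pull F d = ({p \<in> points M. F p \<in> cdom d}, \<lambda>p. snd d (F p))"

lemma chart_pull_image:
  assumes "F \<in> diffeos M" "d \<in> atlas M" "V \<subseteq> points M"
  shows "snd (chart_pull F d) ` (cdom (chart_pull F d) \<inter> {p \<in> points M. F p \<in> V}) = snd d ` (cdom d \<inter> V)"
proof -
  have "snd d q \<in> (\<lambda>p. snd d (F p)) ` ({p \<in> points M. F p \<in> cdom d} \<inter> {p \<in> points M. F p \<in> V})"
    if "q \<in> cdom d" "q \<in> V" for q
    using that assms(3) diffeosD(5,7)[OF assms(1), of q] by (intro image_eqI[of _ _ "dinv F q"]) auto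
  then show ?thesis by (auto simp: chart_pull_def)
qed

lemma chart_pull_cimage:
  assumes "F \<in> diffeos M" "d \<in> atlas M"
  shows "cimage (chart_pull F d) = cimage d"
proof -
  have "cdom (chart_pull F d) \<inter> {p \<in> points M. F p \<in> points M} = cdom (chart_pull F d)"
    "cdom d \<inter> points M = cdom d"
    using diffeosD(4)[OF assms(1)] chartD(3)[OF assms(2)] by (auto simp: chart_pull_def)
  then show ?thesis using chart_pull_image[OF assms order_refl] by simp
qed

lemma chart_pull_topological:
  assumes F: "F \<in> diffeos M" and d: "d \<in> atlas M"
  shows "topological_chart (mtop M) (chart_pull F d)"
  unfolding topological_chart_def
proof (intro conjI)
  show "openin (mtop M) (cdom (chart_pull F d))"
    using diffeosD(2)[OF F] chartD(1)[OF d]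
    by (auto simp: chart_pull_def smooth_map_def continuous_map_def)
  show "open (cimage (chart_pull F d))" using chart_pull_cimage[OF F d] chartD(2)[OF d] by simp
  have "homeomorphic_maps (mtop M) (mtop M) F (dinv F)"
    using diffeosD[OF F] by (simp add: homeomorphic_maps_def smooth_map_def)
  then have "homeomorphic_map (mtop M) (mtop M) F" by (auto simp: homeomorphic_map_maps)
  moreover have "F ` (points M \<inter> cdom (chart_pull F d)) = points M \<inter> cdom d"
    using diffeosD(9)[OF F] by (auto simp: chart_pull_def)
  ultimately have "homeomorphic_map (subtopology (mtop M) (cdom (chart_pull F d))) (subtopology (mtop M) (cdom d)) F"
    by (rule homeomorphic_map_subtopologies)
  moreover have "homeomorphic_map (subtopology (mtop M) (cdom d)) (top_of_set (cimage d)) (snd d)"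
    using atlas_chart[OF d] by (simp add: topological_chart_def)
  ultimately have "homeomorphic_map (subtopology (mtop M) (cdom (chart_pull F d))) (top_of_set (cimage d)) (snd d \<circ> F)"
    by (rule homeomorphic_map_compose)
  then show "homeomorphic_map (subtopology (mtop M) (cdom (chart_pull F d)))
     (top_of_set (cimage (chart_pull F d))) (snd (chart_pull F d))"
    using chart_pull_cimage[OF F d] by (simp add: chart_pull_def comp_def)
qed

lemma chart_pull_cinv:
  assumes F: "F \<in> diffeos M" and d: "d \<in> atlas M" and x: "x \<in> cimage d"
  shows "cinv (chart_pull F d) x = dinv F (cinv d x)"
proof -
  let ?p = "dinv F (cinv d x)"
  have m: "cinv d x \<in> points M" using cinv_in[OF x] chartD(3)[OF d] by blast
  then have "?p \<in> cdom (chart_pull F d)" "snd (chart_pull F d) ?p = x"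
    using diffeosD(5,7)[OF F] cinv_in[OF x] cinv_right[OF x] by (auto simp: chart_pull_def)
  then show ?thesis using cinv_left[OF chart_pull_topological[OF F d], of ?p] by simp
qed

text \<open>By maximality of the atlas only compatibility has to be checked. The transition to a
  chart \<open>e\<close> is the coordinate expression of \<open>dinv F\<close>, and the transition
  back is that of \<open>F\<close>.\<close>

lemma chart_pull_atlas:
  assumes F: "F \<in> diffeos M" and d: "d \<in> atlas M"
  shows "chart_pull F d \<in> atlas M"
proof (rule atlas_maximal[OF chart_pull_topological[OF F d]])
  fix e assume e: "e \<in> atlas M"
  let ?c = "chart_pull F d"
  let ?V = "{p \<in> points M. dinv F p \<in> cdom e}"
  have eq: "snd ?c ` (cdom ?c \<inter> cdom e) = snd d ` (cdom d \<inter> ?V)"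
  proof -
    have "cdom ?c \<inter> cdom e = cdom ?c \<inter> {p \<in> points M. F p \<in> ?V}"
      using chartD(3)[OF e] diffeosD(4,6)[OF F] by (auto simp: chart_pull_def)
    then show ?thesis using chart_pull_image[OF F d, of ?V] by auto
  qed
  have "smooth_fun M ?V (\<lambda>p. snd e (dinv F p) $ i)" for i
    using diffeosD(3)[OF F] e by (simp add: smooth_map_iff)
  then have *: "smooth_on (snd d ` (cdom d \<inter> ?V)) (\<lambda>x. snd e (dinv F (cinv d x)) $ i)" for i
    using d by (auto simp: smooth_fun_def)
  have V: "openin (mtop M) ?V"
    using diffeosD(3)[OF F] chartD(1)[OF e] by (auto simp: smooth_map_def continuous_map_def)
  have "smooth_on (snd d ` (cdom d \<inter> ?V)) (\<lambda>x. snd e (cinv ?c x) $ i)" for i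
    by (rule smooth_on_cong[OF atlas_image_open[OF d V] *]) (auto simp: chart_pull_cinv[OF F d])
  then have "smooth_transition ?c e" unfolding smooth_transition_def eq by blast
  moreover have "smooth_transition e ?c"
  proof -
    have "cdom e \<inter> cdom ?c = {p \<in> cdom e. F p \<in> cdom d}"
      using chartD(3)[OF e] by (auto simp: chart_pull_def)
    then show ?thesis using diffeosD(2)[OF F] e d
      unfolding smooth_transition_def smooth_map_def by (auto simp: chart_pull_def)
  qed
  ultimately show "compatible ?c e" by (simp add: compatible_def)
qed

end

subsection \<open>Metrics and pullback\<close>

lemma det_scaleR_matrix:
  fixes A :: "real^'n^'n::finite"
  shows "det (a *\<^sub>R A) = a ^ CARD('n) * det A"
  by (simp add: det_def prod.distrib sum_distrib_left mult_ac)

lemma continuous_on_det: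
  fixes A :: "'b::topological_space \<Rightarrow> real^'n^'n::finite"
  assumes "\<And>i j. continuous_on S (\<lambda>t. A t $ i $ j)"
  shows "continuous_on S (\<lambda>t. det (A t))"
  unfolding det_def by (intro continuous_intros assms)

text \<open>The determinant has no zero on the segment from the identity to \<open>G\<close>.\<close>

lemma det_pos_if_positive_definite:
  fixes G :: "real^'n^'n::finite"
  assumes pos: "\<And>z. z \<noteq> 0 \<Longrightarrow> z \<bullet> (G *v z) > 0"
  shows "det G > 0"
proof (rule ccontr)
  assume neg: "\<not> det G > 0"
  define A where "A t = (1 - t) *\<^sub>R mat 1 + t *\<^sub>R G" for t
  have "continuous_on {0..1} (\<lambda>t. det (A t))"
    unfolding A_def by (intro continuous_on_det) (auto intro!: continuous_intros)
  moreover have "det (A 0) = 1" "det (A 1) = det G" by (simp_all add: A_def)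
  ultimately obtain t where t: "0 \<le> t" "t \<le> 1" "det (A t) = 0"
    using IVT2'[of "\<lambda>t. det (A t)" 1 0 0] neg by auto
  have "z = 0" if "A t *v z = 0" for z
  proof (rule ccontr)
    assume z: "z \<noteq> 0"
    have "z \<bullet> (A t *v z) = (1 - t) * (z \<bullet> z) + t * (z \<bullet> (G *v z))"
      by (simp add: A_def matrix_vector_mult_add_rdistrib scaleR_matrix_vector_assoc[symmetric]
          inner_add_right)
    also have "\<dots> > 0"
    proof (cases "t = 0")
      case False
      then show ?thesis using t pos[OF z] by (intro add_nonneg_pos mult_nonneg_nonneg mult_pos_pos) auto
    qed (use z in auto)
    finally show False using that by simp
  qed
  then have "invertible (A t)"
    using matrix_left_invertible_ker[of "A t"] invertible_left_inverse by blast
  then show False using t(3) by (simp add: invertible_det_nz)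
qed

lemma conf_metric_conf: "conf_metric \<Upsilon> (conf_metric \<Upsilon>' g) = conf_metric (\<lambda>p. \<Upsilon> p + \<Upsilon>' p) g"
  by (simp add: conf_metric_def fun_eq_iff distrib_left exp_add mult_ac)

lemma conf_metric_zero: "conf_metric (\<lambda>_. 0) g = g"
  by (simp add: conf_metric_def)

lemma metric_coords_conf:
  "metric_coords M (conf_metric \<Upsilon> g) c x = exp (2 * \<Upsilon> (cinv c x)) *\<^sub>R metric_coords M g c x"
  by (simp add: metric_coords_def conf_metric_def vec_eq_iff)

context smooth_mfd
begin

lemma tangent_lincomb:
  "u \<in> tangent_space M p \<Longrightarrow> v \<in> tangent_space M p \<Longrightarrow> (\<lambda>f. a * u f + b * v f) \<in> tangent_space M p"
  by (auto simp: tangent_space_def algebra_simps)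

lemma coord_vec_tangent:
  assumes c: "c \<in> atlas M" and p: "p \<in> cdom c"
  shows "coord_vec M c i p \<in> tangent_space M p"
proof -
  have d: "(\<lambda>x. f (cinv c x)) differentiable (at (snd c p))" if "f \<in> C_inf M" for f
    using smooth_on_differentiable[OF chartD(2)[OF c] C_inf_chart[OF that c]] p by blast
  have dc: "(\<lambda>x. a * f (cinv c x)) differentiable (at (snd c p))" if "f \<in> C_inf M" for f a
    using d[OF that] by (intro derivative_intros)
  show ?thesis
    unfolding tangent_space_def coord_vec_def
    using d dc by (auto simp: C_inf_lincomb C_inf_mult partial_add partial_mult atlas_cinv_left[OF c p])
qed

lemma pushforward_tangent:
  assumes F: "smooth_map M M F" and p: "p \<in> points M" and v: "v \<in> tangent_space M p"
  shows "pushforward M F v \<in> tangent_space M (F p)"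
proof -
  have lin: "pullback M F (\<lambda>q. a * f q + b * h q) = (\<lambda>q. a * pullback M F f q + b * pullback M F h q)"
    and mul: "pullback M F (\<lambda>q. f q * h q) = (\<lambda>q. pullback M F f q * pullback M F h q)"
    and ev: "pullback M F f p = f (F p)" for a b f h
    using p by (auto simp: pullback_def)
  show ?thesis
    using v unfolding tangent_space_def pushforward_def
    by (auto simp: lin mul ev C_inf_lincomb C_inf_mult pullback_C_inf[OF F])
qed

lemma pullback_pullback:
  assumes "smooth_map M M G"
  shows "pullback M G (pullback M F u) = pullback M (compose (points M) F G) u"
proof -
  have "G p \<in> points M" if "p \<in> points M" for p
    using assms that by (auto simp: smooth_map_def continuous_map_def)
  then show ?thesis by (auto simp: pullback_def compose_def)
qed

lemma pullback_id: "u \<in> C_inf M \<Longrightarrow> pullback M (\<lambda>p\<in>points M. p) u = u"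
  by (auto simp: pullback_def C_inf_zero_off)

lemma pushforward_compose:
  assumes "smooth_map M M F" "smooth_map M M G"
  shows "pushforward M (compose (points M) F G) v = pushforward M F (pushforward M G v)"
  using assms by (auto simp: pushforward_def pullback_pullback pullback_C_inf)

lemma pullback_metric_compose:
  assumes F: "smooth_map M M F" and G: "smooth_map M M G"
  shows "pullback_metric M (compose (points M) F G) g = pullback_metric M G (pullback_metric M F g)"
proof -
  have "G p \<in> points M" if "p \<in> points M" for p
    using G that by (auto simp: smooth_map_def continuous_map_def)
  then show ?thesis using pushforward_tangent[OF G]
    by (intro ext) (simp add: pullback_metric_def pushforward_compose[OF F G] compose_eq)
qed

text \<open>Equality of HOL functions, and not merely on tangent vectors, rests on the convention
  that metrics and tangent vectors vanish outside their domains.\<close>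

lemma pullback_metric_id:
  assumes "riemannian_metric M g"
  shows "pullback_metric M (\<lambda>p\<in>points M. p) g = g"
proof -
  have "pushforward M (\<lambda>p\<in>points M. p) v = v" if "v \<in> tangent_space M p" for v p
    using that by (auto simp: pushforward_def pullback_id tangent_space_def fun_eq_iff)
  moreover have "g p v w = 0" if "\<not> (p \<in> points M \<and> v \<in> tangent_space M p \<and> w \<in> tangent_space M p)" for p v w
    using assms that unfolding riemannian_metric_def by blast
  ultimately show ?thesis by (intro ext) (auto simp: pullback_metric_def)
qed

lemma pullback_metric_conf:
  "pullback_metric M F (conf_metric \<Upsilon> g) = conf_metric (pullback M F \<Upsilon>) (pullback_metric M F g)"
  by (auto simp: pullback_metric_def conf_metric_def pullback_def fun_eq_iff)

text \<open>Between the charts \<open>chart_pull F d\<close> and \<open>d\<close> the map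
  \<open>F\<close> is the identity of coordinates: the pullback of \<open>f\<close> has in the first
  the expression that \<open>f\<close> has in the second.\<close>

lemma pushforward_coord_vec:
  assumes F: "F \<in> diffeos M" and d: "d \<in> atlas M" and p: "p \<in> points M" "F p \<in> cdom d"
  shows "pushforward M F (coord_vec M (chart_pull F d) i p) = coord_vec M d i (F p)"
proof
  fix f
  have "pullback M F f (cinv (chart_pull F d) x) = f (cinv d x)" if "x \<in> cimage d" for x
    using that diffeosD(5,7)[OF F, of "cinv d x"] chartD(3)[OF d] cinv_in[OF that]
    by (auto simp: chart_pull_cinv[OF F d] pullback_def)
  then have "partial i (\<lambda>x. pullback M F f (cinv (chart_pull F d) x)) (snd d (F p)) =
      partial i (\<lambda>x. f (cinv d x)) (snd d (F p))"
    using p by (intro partial_cong_open[OF chartD(2)[OF d]]) auto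
  then show "pushforward M F (coord_vec M (chart_pull F d) i p) f = coord_vec M d i (F p) f"
    using pullback_C_inf[OF diffeosD(2)[OF F]]
    by (simp add: pushforward_def coord_vec_def) (simp add: chart_pull_def)
qed

lemma metric_coords_pullback:
  assumes F: "F \<in> diffeos M" and d: "d \<in> atlas M" and x: "x \<in> cimage d"
  shows "metric_coords M (pullback_metric M F g) (chart_pull F d) x = metric_coords M g d x"
proof -
  define p where "p = cinv (chart_pull F d) x"
  have q: "cinv d x \<in> cdom d" "cinv d x \<in> points M" using cinv_in[OF x] chartD(3)[OF d] by blast+
  then have p: "p \<in> points M" "F p = cinv d x" "F p \<in> cdom d"
    using diffeosD(5,7)[OF F] by (auto simp: p_def chart_pull_cinv[OF F d x])
  then have "coord_vec M (chart_pull F d) i p \<in> tangent_space M p" for i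
    by (intro coord_vec_tangent chart_pull_atlas F d) (simp add: chart_pull_def)
  then show ?thesis
    using p pushforward_coord_vec[OF F d p(1,3)]
    by (simp add: metric_coords_def pullback_metric_def flip: p_def)
qed

end

section \<open>Conformal change and positivity of the metric determinant\<close>

locale riemannian = smooth_mfd M for M :: "('a, 'n::finite) manifold" +
  fixes g :: "'a metric"
  assumes metric: "riemannian_metric M g"
begin

lemma riemannian_manifold: "riemannian_manifold M g"
  using smooth_mfd metric by (simp add: riemannian_manifold_def)

lemma metric_sym:
  "p \<in> points M \<Longrightarrow> v \<in> tangent_space M p \<Longrightarrow> w \<in> tangent_space M p \<Longrightarrow> g p v w = g p w v"
  using metric unfolding riemannian_metric_def by blast

lemma metric_linear:
  "p \<in> points M \<Longrightarrow> u \<in> tangent_space M p \<Longrightarrow> v \<in> tangent_space M p \<Longrightarrow> w \<in> tangent_space M p \<Longrightarrow>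
    g p (\<lambda>f. a * u f + b * v f) w = a * g p u w + b * g p v w"
  using metric unfolding riemannian_metric_def by blast

lemma metric_pos:
  "p \<in> points M \<Longrightarrow> v \<in> tangent_space M p \<Longrightarrow> v \<noteq> (\<lambda>_. 0) \<Longrightarrow> g p v v > 0"
  using metric unfolding riemannian_metric_def by blast

lemma riemannian_conf:
  assumes "\<Upsilon> \<in> C_inf M"
  shows "riemannian M (conf_metric \<Upsilon> g)"
proof (unfold_locales, unfold riemannian_metric_def, intro conjI allI impI ballI)
  fix c i j assume c: "c \<in> atlas M"
  have o: "open (cimage c)" by (rule chartD(2)[OF c])
  have "smooth_on (cimage c) (\<lambda>x. 2 * \<Upsilon> (cinv c x))"
    by (rule smooth_on_mult[OF o smooth_on_const[OF o] C_inf_chart[OF assms c]])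
  moreover have "smooth_on (cimage c) (\<lambda>x. metric_coords M g c x $ i $ j)"
    using metric c by (simp add: riemannian_metric_def)
  ultimately have "smooth_on (cimage c) (\<lambda>x. exp (2 * \<Upsilon> (cinv c x)) * metric_coords M g c x $ i $ j)"
    by (rule smooth_on_mult[OF o smooth_on_exp[OF o]])
  then show "smooth_on (cimage c) (\<lambda>x. metric_coords M (conf_metric \<Upsilon> g) c x $ i $ j)"
    by (simp add: metric_coords_conf)
qed (use metric in \<open>auto simp: conf_metric_def riemannian_metric_def algebra_simps\<close>)

lemma metric_sum:
  assumes p: "p \<in> points M" and w: "w \<in> tangent_space M p" and "finite A"
    and u: "\<And>i. i \<in> A \<Longrightarrow> u i \<in> tangent_space M p"
  shows "(\<lambda>f. \<Sum>i\<in>A. z i * u i f) \<in> tangent_space M p"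
    and "g p (\<lambda>f. \<Sum>i\<in>A. z i * u i f) w = (\<Sum>i\<in>A. z i * g p (u i) w)"
proof -
  have "(\<lambda>f. \<Sum>i\<in>A. z i * u i f) \<in> tangent_space M p \<and>
     g p (\<lambda>f. \<Sum>i\<in>A. z i * u i f) w = (\<Sum>i\<in>A. z i * g p (u i) w)"
    using assms(3) u
  proof (induction A rule: finite_induct)
    case empty
    \<comment> \<open>The zero vector arises as a combination of \<open>w\<close> with itself with
      coefficients 0.\<close>
    show ?case using tangent_lincomb[OF w w, of 0 0] metric_linear[OF p w w w, of 0 0] by simp
  next
    case (insert i A)
    then have *: "u i \<in> tangent_space M p" "(\<lambda>f. \<Sum>i\<in>A. z i * u i f) \<in> tangent_space M p"
      "g p (\<lambda>f. \<Sum>i\<in>A. z i * u i f) w = (\<Sum>i\<in>A. z i * g p (u i) w)" by auto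
    from tangent_lincomb[OF *(1,2), of "z i" 1] metric_linear[OF p *(1,2) w, of "z i" 1]
    show ?case using insert.hyps *(3) by simp
  qed
  then show "(\<lambda>f. \<Sum>i\<in>A. z i * u i f) \<in> tangent_space M p"
    and "g p (\<lambda>f. \<Sum>i\<in>A. z i * u i f) w = (\<Sum>i\<in>A. z i * g p (u i) w)" by auto
qed

text \<open>The combination is evaluated on the \<open>j\<close>-th coordinate function. Tangent
  vectors act on global functions only, so this function is first multiplied by a bump that equals 1
  near \<open>p\<close>.\<close>

lemma coord_vec_independent:
  assumes c: "c \<in> atlas M" and p: "p \<in> cdom c"
    and zero: "(\<lambda>f. \<Sum>i\<in>UNIV. z i * coord_vec M c i p f) = (\<lambda>_. 0)"
  shows "z j = 0"
proof -
  obtain \<phi> V where \<phi>: "openin (mtop M) V" "p \<in> V" "V \<subseteq> cdom c" "\<And>q. q \<in> V \<Longrightarrow> \<phi> q = (1::real)"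
    "\<And>u. smooth_fun M (cdom c) u \<Longrightarrow> (\<lambda>q. \<phi> q * u q) \<in> C_inf M"
    using cutoff[OF c chartD(1)[OF c] order_refl p] by metis
  define f where "f q = \<phi> q * snd c q $ j" for q
  have f: "f \<in> C_inf M" unfolding f_def[abs_def] by (intro \<phi>(5) smooth_fun_component c)
  have delta: "coord_vec M c i p f = (if i = j then 1 else 0)" for i
  proof -
    have "partial i (\<lambda>x. f (cinv c x)) (snd c p) = partial i (\<lambda>x. x $ j) (snd c p)"
    proof (rule partial_cong_open[OF atlas_image_open[OF c \<phi>(1)]])
      fix y assume "y \<in> snd c ` (cdom c \<inter> V)"
      then show "f (cinv c y) = y $ j" using \<phi>(4) by (auto simp: f_def atlas_cinv_left[OF c])
    qed (use p \<phi>(2) in auto)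
    also have "\<dots> = axis i 1 $ j"
      by (rule partial_unique) (rule bounded_linear_imp_has_derivative[OF bounded_linear_vec_nth])
    finally show ?thesis using f by (simp add: coord_vec_def axis_def)
  qed
  have "z j = (\<Sum>i\<in>UNIV. z i * coord_vec M c i p f)"
    unfolding delta by (simp add: if_distrib cong: if_cong)
  also have "\<dots> = 0" using fun_cong[OF zero, of f] by simp
  finally show ?thesis .
qed

text \<open>A Gram matrix of independent vectors is positive definite: its quadratic form at
  \<open>z\<close> is the squared length of the combination \<open>?Z\<close>. Strict positivity is
  what makes integrals over small open sets nonzero later.\<close>

lemma det_metric_pos:
  assumes c: "c \<in> atlas M" and x: "x \<in> cimage c"
  shows "det (metric_coords M g c x) > 0"
proof (rule det_pos_if_positive_definite)
  fix z :: "real^'n" assume z: "z \<noteq> 0"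
  define p where "p = cinv c x"
  let ?e = "\<lambda>i. coord_vec M c i p"
  let ?Z = "\<lambda>f. \<Sum>i\<in>UNIV. z $ i * ?e i f"
  have p: "p \<in> cdom c" "p \<in> points M" using cinv_in[OF x] chartD(3)[OF c] by (auto simp: p_def)
  have e: "?e i \<in> tangent_space M p" for i using coord_vec_tangent[OF c p(1)] .
  have Z: "?Z \<in> tangent_space M p" using metric_sum(1)[OF p(2) e, of UNIV ?e "($) z"] e by simp
  have "z \<bullet> (metric_coords M g c x *v z) = (\<Sum>i\<in>UNIV. z $ i * (\<Sum>j\<in>UNIV. z $ j * g p (?e j) (?e i)))"
    using metric_sym[OF p(2) e e]
    by (simp add: inner_vec_def matrix_vector_mult_def metric_coords_def mult.commute flip: p_def)
  also have "\<dots> = (\<Sum>i\<in>UNIV. z $ i * g p (?e i) ?Z)"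
    using metric_sum(2)[OF p(2) e, of UNIV ?e "($) z"] e metric_sym[OF p(2) Z e] by simp
  also have "\<dots> = g p ?Z ?Z"
    using metric_sum(2)[OF p(2) Z, of UNIV ?e "($) z"] e by simp
  also have "\<dots> > 0"
  proof (rule metric_pos[OF p(2) Z])
    show "?Z \<noteq> (\<lambda>_. 0)"
    proof
      assume "?Z = (\<lambda>_. 0)"
      then have "z $ j = 0" for j using coord_vec_independent[OF c p(1), of "($) z"] by simp
      then show False using z by (simp add: vec_eq_iff)
    qed
  qed
  finally show "z \<bullet> (metric_coords M g c x *v z) > 0" .
qed

end

subsection \<open>Naturality and locality of polydifferential operators\<close>

lemma christoffel_cong:
  assumes "open S" "x \<in> S" "\<And>y. y \<in> S \<Longrightarrow> G y = G' y"
  shows "christoffel G l i j x = christoffel G' l i j x"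
  unfolding christoffel_def using assms
  by (auto intro!: sum.cong arg_cong2[where f = "(*)"] arg_cong2[where f = "(+)"] arg_cong2[where f = "(-)"]
      partial_cong_open[OF assms(1,2)])

lemma cov_deriv_cong:
  assumes S: "open S" "x \<in> S" and G: "\<And>y. y \<in> S \<Longrightarrow> G y = G' y"
    and T: "\<And>I y. y \<in> S \<Longrightarrow> T I y = T' I y"
  shows "cov_deriv G T I x = cov_deriv G' T' I x"
proof (cases I)
  case (Cons k J)
  have "partial k (T J) x = partial k (T' J) x"
    by (rule partial_cong_open[OF S]) (rule T)
  then show ?thesis
    using Cons T[OF S(2)] christoffel_cong[OF S G] by (simp add: cov_deriv_def)
qed (simp add: cov_deriv_def)

lemma cov_deriv_funpow_cong:
  assumes S: "open S" and G: "\<And>y. y \<in> S \<Longrightarrow> G y = G' y"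
    and T: "\<And>I y. y \<in> S \<Longrightarrow> T I y = T' I y" and "x \<in> S"
  shows "(cov_deriv G ^^ N) T I x = (cov_deriv G' ^^ N) T' I x"
  using assms(4)
proof (induction N arbitrary: I x)
  case (Suc N)
  then show ?case using cov_deriv_cong[OF S Suc.prems G] by simp
qed (simp add: T)

lemma riemann_cong:
  assumes S: "open S" "x \<in> S" and G: "\<And>y. y \<in> S \<Longrightarrow> G y = G' y"
  shows "riemann G I x = riemann G' I x"
proof -
  have *: "christoffel G l i j y = christoffel G' l i j y" if "y \<in> S" for l i j y
    using christoffel_cong[OF S(1) that G] .
  have "partial k (christoffel G l i j) x = partial k (christoffel G' l i j) x" for k l i j
    by (rule partial_cong_open[OF S]) (rule *)
  then show ?thesis using *[OF S(2)] G[OF S(2)] by (simp add: riemann_def Let_def)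
qed

lemma tensor_prod_cong:
  assumes "list_all2 (\<lambda>a b. fst a = fst b \<and> (\<forall>I. snd a I x = snd b I x)) Ts Ts'"
  shows "tensor_prod Ts I x = tensor_prod Ts' I x"
  using assms
proof (induction arbitrary: I rule: list_all2_induct)
  case (Cons a Ts b Ts')
  then show ?case by (cases a; cases b) simp
qed simp

text \<open>All ingredients are built from \<open>G\<close> and \<open>us\<close> by partial
  derivatives and pointwise algebra, so only germs at \<open>x\<close> matter. One metric with two
  lists of functions gives locality; coordinate expressions in two charts give naturality.\<close>

lemma eval_term_cong:
  assumes S: "open S" "x \<in> S" and G: "\<And>y. y \<in> S \<Longrightarrow> G y = G' y"
    and us: "list_all2 (\<lambda>u v. \<forall>y\<in>S. u y = v y) us vs"
  shows "eval_term G us t x = eval_term G' vs t x"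
proof -
  obtain a Ns Ks P where t: "t = (a, Ns, Ks, P)" by (cases t) auto
  let ?R = "\<lambda>a b. fst a = fst b \<and> (\<forall>I. snd a I x = snd b I x)"
  have "list_all2 ?R (map (\<lambda>N. (N + 4, (cov_deriv G ^^ N) (riemann G))) Ns)
      (map (\<lambda>N. (N + 4, (cov_deriv G' ^^ N) (riemann G'))) Ns)"
    using cov_deriv_funpow_cong[OF S(1) G riemann_cong[OF S(1) _ G] S(2)]
    by (simp add: list_all2_conv_all_nth)
  moreover have "list_all2 ?R (map (\<lambda>(K, u). (K, (cov_deriv G ^^ K) (\<lambda>_. u))) (zip Ks us))
      (map (\<lambda>(K, u). (K, (cov_deriv G' ^^ K) (\<lambda>_. u))) (zip Ks vs))"
    using us cov_deriv_funpow_cong[OF S(1) G _ S(2)]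
    by (auto simp: list_all2_conv_all_nth)
  ultimately have "tensor_prod (map (\<lambda>N. (N + 4, (cov_deriv G ^^ N) (riemann G))) Ns @
      map (\<lambda>(K, u). (K, (cov_deriv G ^^ K) (\<lambda>_. u))) (zip Ks us)) I x =
     tensor_prod (map (\<lambda>N. (N + 4, (cov_deriv G' ^^ N) (riemann G'))) Ns @
      map (\<lambda>(K, u). (K, (cov_deriv G' ^^ K) (\<lambda>_. u))) (zip Ks vs)) I x" for I
    by (intro tensor_prod_cong list_all2_appendI)
  then show ?thesis using G[OF S(2)] by (simp add: t complete_contraction_def)
qed

context riemannian
begin

lemma polydiff_C_inf:
  "polydiff_op r D \<Longrightarrow> us \<in> tuples (C_inf M) (r - 1) \<Longrightarrow> D M g us \<in> C_inf M"
  using riemannian_manifold unfolding polydiff_op_def multilinear_on_def by blast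

lemma polydiff_local:
  assumes D: "polydiff_op r D" and us: "us \<in> tuples (C_inf M) (r - 1)" and vs: "vs \<in> tuples (C_inf M) (r - 1)"
    and U: "openin (mtop M) U" "p \<in> U" and eq: "list_all2 (\<lambda>u v. \<forall>q\<in>U. u q = v q) us vs"
  shows "D M g us p = D M g vs p"
proof -
  obtain ts where ts: "\<And>us c p. us \<in> tuples (C_inf M) (r - 1) \<Longrightarrow> c \<in> atlas M \<Longrightarrow> p \<in> cdom c \<Longrightarrow>
      D M g us p = (\<Sum>t\<leftarrow>ts. eval_term (metric_coords M g c) (map (\<lambda>u x. u (cinv c x)) us) t (snd c p))"
    using D riemannian_manifold unfolding polydiff_op_def by blast
  have "p \<in> points M" using U openin_subset by blast
  then obtain c where c: "c \<in> atlas M" "p \<in> cdom c" by (rule points_chart)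
  have "eval_term (metric_coords M g c) (map (\<lambda>u x. u (cinv c x)) us) t (snd c p) =
      eval_term (metric_coords M g c) (map (\<lambda>u x. u (cinv c x)) vs) t (snd c p)" for t
  proof (rule eval_term_cong[OF atlas_image_open[OF c(1) U(1)]])
    show "list_all2 (\<lambda>u v. \<forall>y\<in>snd c ` (cdom c \<inter> U). u y = v y)
       (map (\<lambda>u x. u (cinv c x)) us) (map (\<lambda>u x. u (cinv c x)) vs)"
      unfolding list_all2_map1 list_all2_map2
      by (rule list_all2_mono[OF eq]) (auto simp: atlas_cinv_left[OF c(1)])
  qed (use c U(2) in auto)
  then show ?thesis using ts[OF us c] ts[OF vs c] by simp
qed

text \<open>In the applications the pulled back metric is \<open>conf_metric \<Upsilon> g\<close>,
  and \<open>riemannian_conf\<close> supplies \<open>rF\<close>.\<close>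

lemma polydiff_natural:
  assumes D: "polydiff_op r D" and us: "us \<in> tuples (C_inf M) (r - 1)"
    and F: "F \<in> diffeos M" and rF: "riemannian M (pullback_metric M F g)"
  shows "D M (pullback_metric M F g) (map (pullback M F) us) = pullback M F (D M g us)"
proof
  fix p
  interpret P: riemannian M "pullback_metric M F g" by (rule rF)
  have us': "map (pullback M F) us \<in> tuples (C_inf M) (r - 1)"
    using us pullback_C_inf[OF diffeosD(2)[OF F]] by auto
  show "D M (pullback_metric M F g) (map (pullback M F) us) p = pullback M F (D M g us) p"
  proof (cases "p \<in> points M")
    case False
    then show ?thesis
      using C_inf_zero_off[OF P.polydiff_C_inf[OF D us']] by (simp add: pullback_def)
  next
    case p: True
    obtain ts where ts: "\<And>g us c p. riemannian_manifold M g \<Longrightarrow> us \<in> tuples (C_inf M) (r - 1) \<Longrightarrow>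
        c \<in> atlas M \<Longrightarrow> p \<in> cdom c \<Longrightarrow>
        D M g us p = (\<Sum>t\<leftarrow>ts. eval_term (metric_coords M g c) (map (\<lambda>u x. u (cinv c x)) us) t (snd c p))"
      using D unfolding polydiff_op_def by blast
    obtain d where d: "d \<in> atlas M" "F p \<in> cdom d" using diffeosD(4)[OF F p] by (rule points_chart)
    let ?c = "chart_pull F d"
    have c: "?c \<in> atlas M" "p \<in> cdom ?c" "snd ?c p = snd d (F p)"
      using chart_pull_atlas[OF F d(1)] p d(2) by (auto simp: chart_pull_def)
    have "eval_term (metric_coords M (pullback_metric M F g) ?c)
        (map (\<lambda>u x. u (cinv ?c x)) (map (pullback M F) us)) t (snd d (F p)) =
        eval_term (metric_coords M g d) (map (\<lambda>u x. u (cinv d x)) us) t (snd d (F p))" for t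
    proof (rule eval_term_cong[OF chartD(2)[OF d(1)]])
      have "pullback M F u (cinv ?c x) = u (cinv d x)" if "x \<in> cimage d" for u x
        using that diffeosD(5,7)[OF F, of "cinv d x"] chartD(3)[OF d(1)] cinv_in[OF that]
        by (auto simp: chart_pull_cinv[OF F d(1)] pullback_def)
      then show "list_all2 (\<lambda>u v. \<forall>y\<in>cimage d. u y = v y)
        (map (\<lambda>u x. u (cinv ?c x)) (map (pullback M F) us)) (map (\<lambda>u x. u (cinv d x)) us)"
        by (simp add: list_all2_conv_all_nth)
    qed (use d(2) metric_coords_pullback[OF F d(1)] in auto)
    then show ?thesis
      using ts[OF P.riemannian_manifold us' c(1,2)] ts[OF riemannian_manifold us d] p c(3)
      by (simp add: pullback_def)
  qed
qed

end

subsection \<open>The volume measure\<close>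

text \<open>A sum over \<open>nat\<close> is an integral against the counting measure, and
  nonnegative series may be integrated termwise.\<close>

lemma suminf_swap_ennreal:
  fixes f :: "nat \<Rightarrow> nat \<Rightarrow> ennreal"
  shows "(\<Sum>i. \<Sum>n. f n i) = (\<Sum>n. \<Sum>i. f n i)"
  using nn_integral_suminf[of f "count_space UNIV"] by (simp add: nn_integral_count_space_nat)

context smooth_mfd
begin

text \<open>The choice defining \<open>chart_seq\<close> has a witness: second countability gives
  the Lindelof property, hence a countable cover by chart domains.\<close>

lemma chart_seq:
  shows "chart_seq M i \<in> atlas M" and "(\<Union>i. cdom (chart_seq M i)) = points M"
proof -
  have "Lindelof_space (mtop M)"
    using smooth_mfd by (simp add: smooth_manifold_def second_countable_imp_Lindelof_space)
  moreover have "\<Union> (fst ` atlas M) = points M"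
    using smooth_mfd by (simp add: smooth_manifold_def)
  moreover have "openin (mtop M) U" if "U \<in> fst ` atlas M" for U
    using that chartD(1) by blast
  ultimately obtain \<V> where V: "countable \<V>" "\<V> \<subseteq> fst ` atlas M" "\<Union>\<V> = points M"
    using Lindelof_spaceD[of "mtop M" "fst ` atlas M"] by metis
  \<comment> \<open>The subcover may be empty when the manifold is, and \<open>from_nat_into\<close>
    enumerates nonempty sets only. The empty chart, in the atlas by maximality, is added without
    changing the union.\<close>
  have "({}, \<lambda>_. 0) \<in> atlas M"
  proof (rule atlas_maximal)
    show "topological_chart (mtop M) ({}, \<lambda>_. 0)"
      by (simp add: topological_chart_def homeomorphic_eq_everything_map open_map_def closed_map_def)
    fix d :: "('a, 'n) chart"
    have "smooth_on {} f" for f :: "real^'n \<Rightarrow> real"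
      by (rule smooth_on_local) auto
    then show "compatible ({}, \<lambda>_. 0) d" by (simp add: compatible_def smooth_transition_def)
  qed
  then have ne: "insert ({}) \<V> \<subseteq> fst ` atlas M" using V(2) by force
  define D where "D = from_nat_into (insert {} \<V>)"
  have D: "range D = insert {} \<V>"
    unfolding D_def using V(1) by (intro range_from_nat_into) auto
  then have "D i \<in> fst ` atlas M" for i using ne by (metis rangeI subsetD)
  then have "\<exists>c. c \<in> atlas M \<and> fst c = D i" for i by (metis imageE)
  then have "\<exists>cs. \<forall>i. cs i \<in> atlas M \<and> fst (cs i) = D i" by (intro choice allI)
  then obtain cs where cs: "\<And>i. cs i \<in> atlas M" "\<And>i. fst (cs i) = D i" by blast
  then have "\<exists>cs::nat \<Rightarrow> _. range cs \<subseteq> atlas M \<and> (\<Union>i. cdom (cs i)) = points M"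
    using D V(3) by (intro exI[of _ cs]) auto
  from someI_ex[OF this] show "chart_seq M i \<in> atlas M" "(\<Union>i. cdom (chart_seq M i)) = points M"
    unfolding chart_seq_def by blast+
qed

text \<open>Every \<open>vol M g\<close> and every piece of it carries this sigma-algebra, so one
  measurability proof serves all metrics.\<close>

definition borelM :: "'a measure" where
  "borelM = sigma (points M) {U. openin (mtop M) U}"

lemma opens_Pow: "{U. openin (mtop M) U} \<subseteq> Pow (points M)"
  by (auto dest: openin_subset)

lemma space_borelM [simp]: "space borelM = points M"
  by (simp add: borelM_def opens_Pow)

lemma sets_borelM: "sets borelM = sigma_sets (points M) {U. openin (mtop M) U}"
  by (simp add: borelM_def opens_Pow)

lemma open_borelM: "openin (mtop M) U \<Longrightarrow> U \<in> sets borelM"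
  by (simp add: sets_borelM sigma_sets.Basic)

lemma piece_borelM: "chart_piece M i \<in> sets borelM"
  unfolding chart_piece_def
  by (intro sets.Diff sets.finite_UN open_borelM chartD(1) chart_seq) auto

lemma piece_cdom: "chart_piece M i \<subseteq> cdom (chart_seq M i)"
  by (auto simp: chart_piece_def)

lemma C_inf_borelM: 
  assumes "u \<in> C_inf M" shows "u \<in> borel_measurable borelM"
proof (rule borel_measurableI)
  fix S :: "real set" assume "open S"
  then have "openin (mtop M) {p \<in> points M. u p \<in> S}"
    using C_inf_continuous[OF assms] by (auto simp: continuous_map_def)
  moreover have "{p \<in> points M. u p \<in> S} = u -` S \<inter> space borelM" by auto
  ultimately show "u -` S \<inter> space borelM \<in> sets borelM" using open_borelM by simp
qed

text \<open>Off \<open>cimage c\<close> the value of \<open>cinv c\<close> is an arbitrary choice,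
  hence the restricted space.\<close>

lemma cinv_measurable:
  assumes c: "c \<in> atlas M"
  shows "cinv c \<in> measurable (restrict_space lborel (cimage c)) borelM"
  unfolding borelM_def
proof (rule measurable_measure_of[OF opens_Pow])
  show "cinv c \<in> space (restrict_space lborel (cimage c)) \<rightarrow> points M"
    using cinv_in[of _ c] chartD(3)[OF c] by (auto simp: space_restrict_space)
  fix U assume "U \<in> {U. openin (mtop M) U}"
  then have "open (snd c ` (cdom c \<inter> U))" using atlas_image_open[OF c] by simp
  moreover have "cinv c -` U \<inter> space (restrict_space lborel (cimage c)) = snd c ` (cdom c \<inter> U)"
    by (auto simp: space_restrict_space atlas_cinv_left[OF c])
  moreover have "snd c ` (cdom c \<inter> U) \<subseteq> cimage c" by auto
  ultimately show "cinv c -` U \<inter> space (restrict_space lborel (cimage c)) \<in> sets (restrict_space lborel (cimage c))"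
    using chartD(2)[OF c] by (subst sets_restrict_space_iff) auto
qed

end

context riemannian
begin

definition vol_density :: "nat \<Rightarrow> real^'n \<Rightarrow> ennreal" where
  "vol_density i x = ennreal (sqrt (det (metric_coords M g (chart_seq M i) x))) *
     indicator (chart_piece M i) (cinv (chart_seq M i) x)"

text \<open>The \<open>i\<close>-th summand of \<open>vol\<close>, written as a push-forward: it is
  then a measure by construction, and integrals against it become Lebesgue integrals by
  \<open>nn_integral_distr\<close>.\<close>

definition piece_measure :: "nat \<Rightarrow> 'a measure" where
  "piece_measure i = distr (density (restrict_space lborel (cimage (chart_seq M i))) (vol_density i))
     borelM (cinv (chart_seq M i))"

lemma sets_piece_measure [simp]: "sets (piece_measure i) = sets borelM"
  and space_piece_measure [simp]: "space (piece_measure i) = points M"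
  by (simp_all add: piece_measure_def)

lemma continuous_on_sqrt_det:
  assumes "c \<in> atlas M"
  shows "continuous_on (cimage c) (\<lambda>x. sqrt (det (metric_coords M g c x)))"
proof -
  have "continuous_on (cimage c) (\<lambda>x. metric_coords M g c x $ i $ j)" for i j
    using metric assms by (auto simp: riemannian_metric_def intro: smooth_on_continuous)
  then have "continuous_on (cimage c) (\<lambda>x. det (metric_coords M g c x))"
    by (rule continuous_on_det)
  then show ?thesis by (intro continuous_intros)
qed

lemma vol_density_measurable:
  "vol_density i \<in> borel_measurable (restrict_space lborel (cimage (chart_seq M i)))"
proof -
  let ?c = "chart_seq M i"
  have [measurable]: "cinv ?c \<in> measurable (restrict_space lborel (cimage ?c)) borelM"
    by (rule cinv_measurable[OF chart_seq(1)])
  have [measurable]: "chart_piece M i \<in> sets borelM" by (rule piece_borelM)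
  have "(\<lambda>x. sqrt (det (metric_coords M g ?c x))) \<in> borel_measurable (restrict_space borel (cimage ?c))"
    by (rule borel_measurable_continuous_on_restrict[OF continuous_on_sqrt_det[OF chart_seq(1)]])
  then have [measurable]: "(\<lambda>x. sqrt (det (metric_coords M g ?c x))) \<in> borel_measurable (restrict_space lborel (cimage ?c))"
    by (simp cong: measurable_cong_sets sets_restrict_space_cong)
  show ?thesis unfolding vol_density_def[abs_def] by measurable
qed

lemma nn_integral_piece_measure:
  assumes [measurable]: "f \<in> borel_measurable borelM"
  shows "(\<integral>\<^sup>+p. f p \<partial>piece_measure i) = (\<integral>\<^sup>+x. vol_density i x * f (cinv (chart_seq M i) x) *
    indicator (cimage (chart_seq M i)) x \<partial>lborel)"
proof -
  let ?c = "chart_seq M i"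
  have [measurable]: "cinv ?c \<in> measurable (restrict_space lborel (cimage ?c)) borelM"
    by (rule cinv_measurable[OF chart_seq(1)])
  note vol_density_measurable[of i, measurable]
  have "cimage ?c \<in> sets lborel" using chartD(2)[OF chart_seq(1)] by simp
  then show ?thesis
    unfolding piece_measure_def
    by (subst nn_integral_distr, measurable)
       (simp add: nn_integral_density nn_integral_restrict_space)
qed

lemma vol_eq: "vol M g = measure_of (points M) {U. openin (mtop M) U} (\<lambda>A. \<Sum>i. emeasure (piece_measure i) A)"
  unfolding vol_def
proof (rule measure_of_eq[OF opens_Pow])
  fix A assume "A \<in> sigma_sets (points M) {U. openin (mtop M) U}"
  then have A: "A \<in> sets borelM" by (simp add: sets_borelM)
  have "(\<integral>\<^sup>+x. ennreal (sqrt (det (metric_coords M g (chart_seq M i) x))) *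
      indicator (snd (chart_seq M i) ` (A \<inter> chart_piece M i)) x \<partial>lborel) = emeasure (piece_measure i) A" for i
  proof -
    let ?c = "chart_seq M i"
    \<comment> \<open>On the chart image \<open>cinv\<close> inverts the chart, so lying in the
      image of a set means that \<open>cinv ?c x\<close> lies in the set. Off the chart image both
      sides are 0.\<close>
    have "(indicator (snd ?c ` (A \<inter> chart_piece M i)) x :: ennreal) =
        indicator (chart_piece M i) (cinv ?c x) * indicator A (cinv ?c x) * indicator (cimage ?c) x" for x
    proof (cases "x \<in> cimage ?c")
      case True
      have "x \<in> snd ?c ` (A \<inter> chart_piece M i) \<longleftrightarrow> cinv ?c x \<in> A \<inter> chart_piece M i"
      proof
        assume "x \<in> snd ?c ` (A \<inter> chart_piece M i)"
        then obtain q where "q \<in> A \<inter> chart_piece M i" "x = snd ?c q" by blast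
        then show "cinv ?c x \<in> A \<inter> chart_piece M i"
          using piece_cdom[of i] atlas_cinv_left[OF chart_seq(1), of q i] by auto
      next
        assume "cinv ?c x \<in> A \<inter> chart_piece M i"
        then show "x \<in> snd ?c ` (A \<inter> chart_piece M i)"
          using cinv_right[OF True] by (metis image_eqI)
      qed
      then show ?thesis using True by (auto simp: indicator_def)
    next
      case False
      then have "x \<notin> snd ?c ` (A \<inter> chart_piece M i)" using piece_cdom[of i] by blast
      then show ?thesis using False by simp
    qed
    then have "(\<integral>\<^sup>+x. ennreal (sqrt (det (metric_coords M g ?c x))) *
        indicator (snd ?c ` (A \<inter> chart_piece M i)) x \<partial>lborel) = (\<integral>\<^sup>+p. indicator A p \<partial>piece_measure i)"
      using A by (subst nn_integral_piece_measure) (auto simp: vol_density_def mult_ac)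
    then show ?thesis using A by simp
  qed
  then show "(\<Sum>i. \<integral>\<^sup>+x. ennreal (sqrt (det (metric_coords M g (chart_seq M i) x))) *
      indicator (snd (chart_seq M i) ` (A \<inter> chart_piece M i)) x \<partial>lborel) = (\<Sum>i. emeasure (piece_measure i) A)"
    by simp
qed

lemma space_vol [simp]: "space (vol M g) = points M"
  by (simp add: vol_def opens_Pow)

lemma sets_vol: "sets (vol M g) = sets borelM"
  by (simp add: vol_def opens_Pow sets_borelM)

text \<open>\<open>measure_of\<close> yields its set function only if that is countably additive,
  and the zero measure otherwise. Additivity is inherited from the pieces by exchanging the two
  sums.\<close>

lemma emeasure_vol:
  assumes "A \<in> sets borelM"
  shows "emeasure (vol M g) A = (\<Sum>i. emeasure (piece_measure i) A)"
proof (rule emeasure_measure_of[OF vol_eq opens_Pow])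
  show "positive (sets (vol M g)) (\<lambda>A. \<Sum>i. emeasure (piece_measure i) A)"
    by (simp add: positive_def)
  show "countably_additive (sets (vol M g)) (\<lambda>A. \<Sum>i. emeasure (piece_measure i) A)"
  proof (rule countably_additiveI)
    fix A :: "nat \<Rightarrow> 'a set" assume "range A \<subseteq> sets (vol M g)" "disjoint_family A"
    then have "(\<Sum>n. emeasure (piece_measure i) (A n)) = emeasure (piece_measure i) (\<Union> (range A))" for i
      by (intro suminf_emeasure) (simp_all add: sets_vol)
    then show "(\<Sum>n. \<Sum>i. emeasure (piece_measure i) (A n)) = (\<Sum>i. emeasure (piece_measure i) (\<Union> (range A)))"
      by (subst suminf_swap_ennreal) simp
  qed
qed (use assms in \<open>simp add: sets_vol\<close>)

lemma nn_integral_vol_pieces: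
  assumes "f \<in> borel_measurable borelM"
  shows "(\<integral>\<^sup>+p. f p \<partial>vol M g) = (\<Sum>i. \<integral>\<^sup>+p. f p \<partial>piece_measure i)"
  using assms
proof (induction rule: borel_measurable_induct)
  case (cong f h)
  then have "(\<integral>\<^sup>+p. f p \<partial>N) = (\<integral>\<^sup>+p. h p \<partial>N)" if "space N = points M" for N
    using that by (intro nn_integral_cong) simp
  then show ?case using cong by simp
next
  case (set A)
  then show ?case using emeasure_vol by (simp add: sets_vol)
next
  case (mult u c)
  then have "u \<in> borel_measurable (vol M g)" "u \<in> borel_measurable (piece_measure i)" for i
    by (auto simp: sets_vol cong: measurable_cong_sets)
  then show ?case using mult by (simp add: nn_integral_cmult ennreal_suminf_cmult)
next
  case (add u v)
  then have "u \<in> borel_measurable (vol M g)" "u \<in> borel_measurable (piece_measure i)" 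
    "v \<in> borel_measurable (vol M g)" "v \<in> borel_measurable (piece_measure i)" for i
    by (auto simp: sets_vol cong: measurable_cong_sets)
  then show ?case using add by (simp add: nn_integral_add suminf_add)
next
  case (seq U)
  then have m: "U n \<in> borel_measurable (vol M g)" "U n \<in> borel_measurable (piece_measure i)" for i n
    by (auto simp: sets_vol cong: measurable_cong_sets)
  have inc: "incseq (\<lambda>n i. \<integral>\<^sup>+p. U n p \<partial>piece_measure i)"
    using seq(3) by (auto simp: incseq_def le_fun_def intro!: nn_integral_mono)
  have "(\<integral>\<^sup>+p. (SUP n. U n p) \<partial>vol M g) = (SUP n. \<Sum>i. \<integral>\<^sup>+p. U n p \<partial>piece_measure i)"
    using seq(3) m seq.IH by (simp add: nn_integral_monotone_convergence_SUP)
  \<comment> \<open>As an integral against the counting measure, the sum over the pieces commutes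
    with the supremum by monotone convergence.\<close>
  also have "\<dots> = (SUP n. \<integral>\<^sup>+i. (\<integral>\<^sup>+p. U n p \<partial>piece_measure i) \<partial>count_space UNIV)"
    by (simp add: nn_integral_count_space_nat)
  also have "\<dots> = (\<integral>\<^sup>+i. (SUP n. \<integral>\<^sup>+p. U n p \<partial>piece_measure i) \<partial>count_space UNIV)"
    using inc by (intro nn_integral_monotone_convergence_SUP[symmetric]) auto
  also have "\<dots> = (\<Sum>i. \<integral>\<^sup>+p. (SUP n. U n p) \<partial>piece_measure i)"
    using seq(3) m by (simp add: nn_integral_count_space_nat nn_integral_monotone_convergence_SUP)
  finally show ?case by (simp add: SUP_apply[abs_def] image_comp)
qed

lemma nn_integral_vol:
  assumes "f \<in> borel_measurable borelM"
  shows "(\<integral>\<^sup>+p. f p \<partial>vol M g) = (\<Sum>i. \<integral>\<^sup>+x. vol_density i x * f (cinv (chart_seq M i) x) *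
    indicator (cimage (chart_seq M i)) x \<partial>lborel)"
  using nn_integral_vol_pieces[OF assms] nn_integral_piece_measure[OF assms] by simp

lemma C_inf_vol: "u \<in> C_inf M \<Longrightarrow> u \<in> borel_measurable (vol M g)"
  using C_inf_borelM measurable_cong_sets[OF sets_vol refl] by blast

end

text \<open>The sequence of charts depends on \<open>M\<close> alone, so both measures are cut into
  the same pieces and can be compared density by density. The matrix of the metric is multiplied by
  exp (2 \<Upsilon>), its determinant by the n-th power of that, and the square root leaves exp (n
  \<Upsilon>).\<close>

lemma (in riemannian) vol_conf:
  assumes Y: "\<Upsilon> \<in> C_inf M"
  shows "vol M (conf_metric \<Upsilon> g) = density (vol M g) (\<lambda>p. ennreal (exp (real CARD('n) * \<Upsilon> p)))"
proof (rule measure_eqI)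
  interpret C: riemannian M "conf_metric \<Upsilon> g" by (rule riemannian_conf[OF Y])
  let ?J = "\<lambda>p. ennreal (exp (real CARD('n) * \<Upsilon> p))"
  note C_inf_borelM[OF Y, measurable]
  have [measurable]: "?J \<in> borel_measurable borelM" by measurable
  then have J: "?J \<in> borel_measurable (vol M g)" using measurable_cong_sets[OF sets_vol refl] by blast
  show "sets (vol M (conf_metric \<Upsilon> g)) = sets (density (vol M g) ?J)"
    by (simp add: sets_vol C.sets_vol)
  fix A assume "A \<in> sets (vol M (conf_metric \<Upsilon> g))"
  then have A [measurable]: "A \<in> sets borelM" by (simp add: C.sets_vol)
  have "C.vol_density i x = vol_density i x * ?J (cinv (chart_seq M i) x)" for i x
  proof -
    let ?y = "\<Upsilon> (cinv (chart_seq M i) x)"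
    have "sqrt (exp (2 * ?y) ^ CARD('n)) = exp (real CARD('n) * ?y)"
      by (rule real_sqrt_unique)
        (simp_all add: power2_eq_square exp_of_nat_mult[symmetric] exp_add[symmetric])
    then show ?thesis
      by (simp add: vol_density_def C.vol_density_def metric_coords_conf det_scaleR_matrix
          real_sqrt_mult ennreal_mult'' mult_ac)
  qed
  moreover have "emeasure (vol M (conf_metric \<Upsilon> g)) A = (\<integral>\<^sup>+p. indicator A p \<partial>vol M (conf_metric \<Upsilon> g))"
    using A by (simp add: C.sets_vol)
  moreover have "emeasure (density (vol M g) ?J) A = (\<integral>\<^sup>+p. ?J p * indicator A p \<partial>vol M g)"
    using A J by (simp add: emeasure_density sets_vol)
  ultimately show "emeasure (vol M (conf_metric \<Upsilon> g)) A = emeasure (density (vol M g) ?J) A"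
    by (simp add: nn_integral_vol C.nn_integral_vol mult_ac)
qed

subsection \<open>Conformal covariance\<close>

context riemannian
begin

lemma C_inf_compact_imp: "u \<in> C_inf_compact M \<Longrightarrow> u \<in> C_inf M"
  by (simp add: C_inf_compact_def)

section \<open>Integrals of functions supported in one piece\<close>

lemma pieces_disjoint:
  assumes "p \<in> chart_piece M i" "p \<in> chart_piece M j" shows "i = j"
proof (rule ccontr)
  assume "i \<noteq> j"
  then consider "i < j" | "j < i" by linarith
  then show False using assms by cases (auto simp: chart_piece_def)
qed

lemma nn_integral_vol_piece:
  assumes u: "u \<in> C_inf M" and supp: "\<And>q. u q \<noteq> 0 \<Longrightarrow> q \<in> chart_piece M N"
  defines "c \<equiv> chart_seq M N"
  shows "(\<integral>\<^sup>+q. ennreal \<bar>u q\<bar> \<partial>vol M g) =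
    (\<integral>\<^sup>+x. ennreal (indicator (cimage c) x *\<^sub>R (sqrt (det (metric_coords M g c x)) * \<bar>u (cinv c x)\<bar>)) \<partial>lborel)"
proof -
  note C_inf_borelM[OF u, measurable]
  have "(\<integral>\<^sup>+q. ennreal \<bar>u q\<bar> \<partial>vol M g) = (\<Sum>i. \<integral>\<^sup>+x. vol_density i x * ennreal \<bar>u (cinv (chart_seq M i) x)\<bar> *
      indicator (cimage (chart_seq M i)) x \<partial>lborel)"
    by (rule nn_integral_vol) measurable
  also have "\<dots> = (\<integral>\<^sup>+x. vol_density N x * ennreal \<bar>u (cinv c x)\<bar> * indicator (cimage c) x \<partial>lborel)"
  proof -
    have zero: "vol_density i x * ennreal \<bar>u (cinv (chart_seq M i) x)\<bar> = 0" if "i \<noteq> N" for i x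
    proof (cases "u (cinv (chart_seq M i) x) = 0")
      case False
      then have "cinv (chart_seq M i) x \<notin> chart_piece M i" using supp pieces_disjoint that by blast
      then show ?thesis by (simp add: vol_density_def)
    qed simp
    have "(\<integral>\<^sup>+x. vol_density i x * ennreal \<bar>u (cinv (chart_seq M i) x)\<bar> *
        indicator (cimage (chart_seq M i)) x \<partial>lborel) = 0" if "i \<noteq> N" for i
      unfolding zero[OF that] by simp
    then show ?thesis
      by (subst suminf_finite[of "{N}"]) (simp_all add: c_def)
  qed
  also have "\<dots> = (\<integral>\<^sup>+x. ennreal (indicator (cimage c) x *\<^sub>R (sqrt (det (metric_coords M g c x)) * \<bar>u (cinv c x)\<bar>)) \<partial>lborel)"
  proof (intro nn_integral_cong)
    fix x
    show "vol_density N x * ennreal \<bar>u (cinv c x)\<bar> * indicator (cimage c) x =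
       ennreal (indicator (cimage c) x *\<^sub>R (sqrt (det (metric_coords M g c x)) * \<bar>u (cinv c x)\<bar>))"
    proof (cases "u (cinv c x) = 0")
      case False
      then have "vol_density N x = ennreal (sqrt (det (metric_coords M g c x)))"
        using supp by (simp add: vol_density_def c_def)
      then show ?thesis by (simp add: ennreal_mult'' indicator_def)
    qed simp
  qed
  finally show ?thesis .
qed

text \<open>In the chart the integrand is continuous, and it is positive near the image of
  \<open>p\<close> because the determinant is. A vanishing integral would make a Euclidean ball a
  null set.\<close>

lemma nn_integral_vol_pos:
  assumes u: "u \<in> C_inf M" and supp: "\<And>q. u q \<noteq> 0 \<Longrightarrow> q \<in> chart_piece M N" and p: "u p \<noteq> 0"
  shows "(\<integral>\<^sup>+q. ennreal \<bar>u q\<bar> \<partial>vol M g) \<noteq> 0"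
proof
  define c where "c = chart_seq M N"
  have c: "c \<in> atlas M" using chart_seq(1) by (simp add: c_def)
  define F where "F x = sqrt (det (metric_coords M g c x)) * \<bar>u (cinv c x)\<bar>" for x
  have cont_u: "continuous_on (cimage c) (\<lambda>x. u (cinv c x))"
    using C_inf_chart[OF u c] by (rule smooth_on_continuous)
  have "continuous_on (cimage c) F"
    unfolding F_def by (intro continuous_on_mult continuous_on_rabs continuous_on_sqrt_det[OF c] cont_u)
  then have "(\<lambda>x. indicator (cimage c) x *\<^sub>R F x) \<in> borel_measurable borel"
    using chartD(2)[OF c] by (intro borel_measurable_continuous_on_indicator) auto
  then have meas: "(\<lambda>x. ennreal (indicator (cimage c) x *\<^sub>R F x)) \<in> borel_measurable lborel"
    by (intro measurable_compose[OF _ measurable_ennreal]) simp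
  assume "(\<integral>\<^sup>+q. ennreal \<bar>u q\<bar> \<partial>vol M g) = 0"
  then have "(\<integral>\<^sup>+x. ennreal (indicator (cimage c) x *\<^sub>R F x) \<partial>lborel) = 0"
    using nn_integral_vol_piece[OF u supp] by (simp add: c_def F_def)
  then have AE: "AE x in lborel. ennreal (indicator (cimage c) x *\<^sub>R F x) = 0"
    unfolding nn_integral_0_iff_AE[OF meas] .
  define W where "W = cimage c \<inter> (\<lambda>x. u (cinv c x)) -` (- {0})"
  have "open W" unfolding W_def
    using cont_u chartD(2)[OF c] by (rule continuous_open_preimage) auto
  moreover have "snd c p \<in> W"
    using supp[OF p] p piece_cdom[of N] by (auto simp: W_def c_def atlas_cinv_left[OF chart_seq(1)])
  ultimately obtain e where e: "e > 0" "ball (snd c p) e \<subseteq> W" using open_contains_ball by blast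
  have pos: "indicator (cimage c) x *\<^sub>R F x > 0" if "x \<in> W" for x
    using that det_metric_pos[OF c] by (auto simp: W_def F_def)
  have "AE x in lborel. x \<notin> ball (snd c p) e"
    using AE
  proof eventually_elim
    case (elim x)
    then have "\<not> indicator (cimage c) x *\<^sub>R F x > 0" by (simp only: ennreal_eq_0_iff not_less)
    then show ?case using pos e(2) by blast
  qed
  then have "ball (snd c p) e \<in> null_sets lborel" by (subst AE_iff_null_sets) auto
  then have "measure lborel (ball (snd c p) e) = 0" by (auto simp: measure_def)
  then show False using content_ball_pos[OF e(1), of "snd c p"] by simp
qed

text \<open>In the chart the integrand is continuous, hence bounded on the compact set
  \<open>K\<close> that carries it, and \<open>K\<close> has finite Lebesgue measure.\<close>

lemma nn_integral_vol_finite: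
  assumes u: "u \<in> C_inf M" and supp: "\<And>q. u q \<noteq> 0 \<Longrightarrow> q \<in> chart_piece M N"
    and K: "compact K" "K \<subseteq> cimage (chart_seq M N)" "\<And>q. u q \<noteq> 0 \<Longrightarrow> snd (chart_seq M N) q \<in> K"
  shows "(\<integral>\<^sup>+q. ennreal \<bar>u q\<bar> \<partial>vol M g) < \<infinity>"
proof -
  define c where "c = chart_seq M N"
  have c: "c \<in> atlas M" using chart_seq(1) by (simp add: c_def)
  define F where "F x = sqrt (det (metric_coords M g c x)) * \<bar>u (cinv c x)\<bar>" for x
  have cont_u: "continuous_on (cimage c) (\<lambda>x. u (cinv c x))"
    using C_inf_chart[OF u c] by (rule smooth_on_continuous)
  have "continuous_on (cimage c) F"
    unfolding F_def by (intro continuous_on_mult continuous_on_rabs continuous_on_sqrt_det[OF c] cont_u)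
  then have "bounded (F ` K)"
    using K by (intro compact_imp_bounded compact_continuous_image) (auto simp: c_def intro: continuous_on_subset)
  then obtain B where B: "\<And>x. x \<in> K \<Longrightarrow> \<bar>F x\<bar> \<le> B" by (auto simp: bounded_iff)
  have "(\<integral>\<^sup>+q. ennreal \<bar>u q\<bar> \<partial>vol M g) = (\<integral>\<^sup>+x. ennreal (indicator (cimage c) x *\<^sub>R F x) \<partial>lborel)"
    using nn_integral_vol_piece[OF u supp] by (simp add: c_def F_def)
  also have "\<dots> \<le> (\<integral>\<^sup>+x. ennreal B * indicator K x \<partial>lborel)"
  proof (intro nn_integral_mono)
    fix x
    show "ennreal (indicator (cimage c) x *\<^sub>R F x) \<le> ennreal B * indicator K x"
    proof (cases "x \<in> K")
      case True
      then show ?thesis using B[OF True] K(2) by (auto simp: c_def intro!: ennreal_leI)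
    next
      case False
      have "u (cinv c x) = 0" if "x \<in> cimage c"
        using K(3)[of "cinv c x"] False cinv_right[OF that] by (auto simp: c_def)
      then show ?thesis by (auto simp: F_def indicator_def)
    qed
  qed
  also have "\<dots> = ennreal B * emeasure lborel K"
    using K(1) by (simp add: nn_integral_cmult_indicator borel_compact)
  also have "\<dots> < \<infinity>"
    using emeasure_compact_finite[OF K(1)] by (simp add: ennreal_mult_less_top)
  finally show ?thesis .
qed

text \<open>Test functions supported in a single piece suffice: the interiors of the pieces are dense.
  This avoids the change of variables formula.\<close>

lemma C_inf_le_by_test:
  assumes h1: "h1 \<in> C_inf M" and h2: "h2 \<in> C_inf M"
    and eq: "\<And>\<phi>. \<phi> \<in> C_inf_compact M \<Longrightarrow>
      (\<integral>q. \<phi> q * h1 q \<partial>vol M g) = (\<integral>q. \<phi> q * h2 q \<partial>vol M g)"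
  shows "h1 p \<le> h2 p"
proof (rule ccontr)
  assume p: "\<not> h1 p \<le> h2 p"
  then have pM: "p \<in> points M" using C_inf_zero_off[OF h1] C_inf_zero_off[OF h2] by fastforce
  define h where "h q = 1 * h1 q + (- 1) * h2 q" for q
  have h: "h \<in> C_inf M" unfolding h_def[abs_def] by (rule C_inf_lincomb[OF h1 h2])
  define U where "U = {q \<in> points M. h q \<in> {0<..}}"
  have "openin (mtop M) {q \<in> points M. h q \<in> W}" if "open W" for W
    using C_inf_continuous[OF h] that by (simp add: continuous_map_def)
  from this[OF open_greaterThan] have U: "openin (mtop M) U" unfolding U_def .
  have pU: "p \<in> U" using p pM by (simp add: U_def h_def)
  \<comment> \<open>No chart before the first one that meets \<open>U\<close> removes anything from
    \<open>U \<inter> cdom c\<close>, so this open set lies in the piece \<open>N\<close>.\<close>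
  define N where "N = (LEAST N. U \<inter> cdom (chart_seq M N) \<noteq> {})"
  define c where "c = chart_seq M N"
  have c: "c \<in> atlas M" using chart_seq(1) by (simp add: c_def)
  have "\<exists>N. U \<inter> cdom (chart_seq M N) \<noteq> {}" using pU pM chart_seq(2) by blast
  then have "U \<inter> cdom c \<noteq> {}" unfolding c_def N_def by (rule LeastI_ex)
  then obtain p1 where p1: "p1 \<in> U \<inter> cdom c" by blast
  define V where "V = U \<inter> cdom c"
  have V: "openin (mtop M) V" "V \<subseteq> cdom c" "p1 \<in> V"
    using U chartD(1)[OF c] p1 by (auto simp: V_def)
  have "U \<inter> cdom (chart_seq M j) = {}" if "j < N" for j
    using not_less_Least[of j "\<lambda>N. U \<inter> cdom (chart_seq M N) \<noteq> {}"] that by (auto simp: N_def)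
  then have VN: "V \<subseteq> chart_piece M N" by (auto simp: V_def chart_piece_def c_def)
  obtain \<phi> e V' where \<phi>: "\<phi> \<in> C_inf_compact M" "\<And>q. 0 \<le> \<phi> q" "e > 0"
    "cball (snd c p1) e \<subseteq> snd c ` V" "\<And>q. \<phi> q \<noteq> 0 \<Longrightarrow> q \<in> cdom c \<and> snd c q \<in> cball (snd c p1) e"
    and V': "openin (mtop M) V'" "p1 \<in> V'" "V' \<subseteq> V" "\<And>q. q \<in> V' \<Longrightarrow> \<phi> q = 1"
    "\<And>u. smooth_fun M V u \<Longrightarrow> (\<lambda>q. \<phi> q * u q) \<in> C_inf M"
    by (rule cutoff[OF c V]) (rule that; assumption)
  have supp: "q \<in> V" if "\<phi> q \<noteq> 0" for q
  proof -
    have "q \<in> cdom c" "snd c q \<in> snd c ` V" using \<phi>(4,5) that by blast+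
    then show ?thesis using V(2) chartD(4)[OF c] by (auto simp: inj_on_def)
  qed
  \<comment> \<open>\<open>int\<close> allows the integral of the difference to be split;
    \<open>fin\<close> excludes that the real integral is 0 only because the extended one is
    infinite.\<close>
  have fin: "(\<integral>\<^sup>+q. ennreal \<bar>\<phi> q * u q\<bar> \<partial>vol M g) < \<infinity>" and int: "integrable (vol M g) (\<lambda>q. \<phi> q * u q)"
    if u: "u \<in> C_inf M" for u
  proof -
    have \<phi>u: "(\<lambda>q. \<phi> q * u q) \<in> C_inf M" by (rule C_inf_mult[OF C_inf_compact_imp[OF \<phi>(1)] u])
    show fin: "(\<integral>\<^sup>+q. ennreal \<bar>\<phi> q * u q\<bar> \<partial>vol M g) < \<infinity>"
    proof (rule nn_integral_vol_finite[OF \<phi>u])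
      show "cball (snd c p1) e \<subseteq> cimage (chart_seq M N)" using \<phi>(4) V(2) by (auto simp: c_def)
    qed (use \<phi>(5) supp VN in \<open>auto simp: c_def\<close>)
    show "integrable (vol M g) (\<lambda>q. \<phi> q * u q)"
      using fin C_inf_vol[OF \<phi>u] by (intro integrableI_bounded) auto
  qed
  have \<phi>h: "(\<lambda>q. \<phi> q * h q) \<in> C_inf M" by (rule C_inf_mult[OF C_inf_compact_imp[OF \<phi>(1)] h])
  have nn: "0 \<le> \<phi> q * h q" for q
    using supp[of q] \<phi>(2)[of q] by (cases "\<phi> q = 0") (auto simp: V_def U_def)
  have "(\<integral>q. \<phi> q * h q \<partial>vol M g) = (\<integral>q. \<phi> q * h1 q - \<phi> q * h2 q \<partial>vol M g)"
    by (simp add: h_def right_diff_distrib)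
  also have "\<dots> = 0" using eq[OF \<phi>(1)] int[OF h1] int[OF h2] by simp
  finally have "enn2real (\<integral>\<^sup>+q. ennreal (\<phi> q * h q) \<partial>vol M g) = 0"
    using nn C_inf_vol[OF \<phi>h] by (simp add: integral_eq_nn_integral)
  then have "(\<integral>\<^sup>+q. ennreal \<bar>\<phi> q * h q\<bar> \<partial>vol M g) = 0"
    using fin[OF h] nn by (auto simp: enn2real_eq_0_iff)
  moreover have "\<phi> p1 * h p1 \<noteq> 0" using V'(2,4) p1 by (simp add: U_def)
  then have "(\<integral>\<^sup>+q. ennreal \<bar>\<phi> q * h q\<bar> \<partial>vol M g) \<noteq> 0"
    using supp VN by (intro nn_integral_vol_pos[OF \<phi>h, of N p1]) auto
  ultimately show False by blast
qed

lemma C_inf_eq_by_test: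
  assumes "h1 \<in> C_inf M" "h2 \<in> C_inf M"
    and "\<And>\<phi>. \<phi> \<in> C_inf_compact M \<Longrightarrow>
      (\<integral>q. \<phi> q * h1 q \<partial>vol M g) = (\<integral>q. \<phi> q * h2 q \<partial>vol M g)"
  shows "h1 = h2"
proof
  fix p
  show "h1 p = h2 p"
    using C_inf_le_by_test[OF assms(1,2), of p] C_inf_le_by_test[OF assms(2,1), of p] assms(3)
    by (simp add: antisym)
qed

text \<open>The definite description needs existence, which is \<open>vol_conf\<close>, and
  uniqueness: two smooth densities of the same measure give equal integrals against all test
  functions, so they agree at every point and not just almost everywhere.\<close>

lemma jacobian_eq:
  assumes Y: "\<Upsilon> \<in> C_inf M" and F: "pullback_metric M F g = conf_metric \<Upsilon> g" and p: "p \<in> points M"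
  shows "jacobian M g F p = exp (real CARD('n) * \<Upsilon> p)"
proof -
  \<comment> \<open>The function 1 is replaced by 0 off the manifold, as membership in
    \<open>C_inf M\<close> demands.\<close>
  define J where "J = exp_mult (real CARD('n)) \<Upsilon> (\<lambda>p. if p \<in> points M then 1 else 0)"
  have J: "J \<in> C_inf M" unfolding J_def by (intro C_inf_exp_mult Y C_inf_const)
  have "jacobian M g F = J"
    unfolding jacobian_def F
  proof (rule the_equality, intro conjI ballI)
    show "J p > 0" if "p \<in> points M" for p using that by (simp add: J_def exp_mult_def)
    show eq: "vol M (conf_metric \<Upsilon> g) = density (vol M g) (\<lambda>p. ennreal (J p))"
      unfolding vol_conf[OF Y]
    proof (rule density_cong)
      show "(\<lambda>p. ennreal (exp (real CARD('n) * \<Upsilon> p))) \<in> borel_measurable (vol M g)"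
        using C_inf_vol[OF Y] by measurable
      show "(\<lambda>p. ennreal (J p)) \<in> borel_measurable (vol M g)"
        using C_inf_vol[OF J] by measurable
      show "AE p in vol M g. ennreal (exp (real CARD('n) * \<Upsilon> p)) = ennreal (J p)"
        by (intro AE_I2) (simp add: J_def exp_mult_def)
    qed
    fix K assume K: "K \<in> C_inf M \<and> (\<forall>p\<in>points M. 0 < K p) \<and>
      vol M (conf_metric \<Upsilon> g) = density (vol M g) (\<lambda>p. ennreal (K p))"
    have nonneg: "AE p in vol M g. 0 \<le> K p" "AE p in vol M g. 0 \<le> J p"
      using K by (auto intro!: AE_I2 less_imp_le simp: J_def exp_mult_def)
    show "K = J"
    proof (rule C_inf_eq_by_test)
      fix \<phi> assume "\<phi> \<in> C_inf_compact M"
      then have \<phi>: "\<phi> \<in> borel_measurable (vol M g)" using C_inf_compact_imp C_inf_vol by blast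
      have "(\<integral>q. \<phi> q * K q \<partial>vol M g) = (\<integral>q. \<phi> q \<partial>density (vol M g) (\<lambda>p. ennreal (K p)))"
        using K nonneg(1) \<phi> C_inf_vol by (subst integral_density) (auto simp: mult.commute)
      also have "\<dots> = (\<integral>q. \<phi> q \<partial>density (vol M g) (\<lambda>p. ennreal (J p)))"
        using K eq by simp
      also have "\<dots> = (\<integral>q. \<phi> q * J q \<partial>vol M g)"
        using nonneg(2) \<phi> C_inf_vol[OF J] by (subst integral_density) (auto simp: mult.commute)
      finally show "(\<integral>q. \<phi> q * K q \<partial>vol M g) = (\<integral>q. \<phi> q * J q \<partial>vol M g)" .
    qed (use K J in auto)
  qed (rule J)
  then show ?thesis using p by (simp add: J_def exp_mult_def)
qed

text \<open>The power - w / n turns exp (n \<Upsilon>) into exp (- w \<Upsilon>). Off the manifold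
  \<open>pullback\<close> is 0, so the value of the Jacobian there does not matter.\<close>

lemma conf_act_eq:
  assumes "\<Upsilon> \<in> C_inf M" and "pullback_metric M F g = conf_metric \<Upsilon> g"
  shows "conf_act M g w u F = exp_mult (- w) \<Upsilon> (pullback M F u)"
proof
  fix p
  show "conf_act M g w u F p = exp_mult (- w) \<Upsilon> (pullback M F u) p"
    using jacobian_eq[OF assms, of p]
    by (cases "p \<in> points M") (simp_all add: conf_act_def exp_mult_def pullback_def exp_powr_real)
qed

text \<open>The invariance of the Dirichlet form only involves compactly supported functions; the
  pointwise law extends to all smooth functions by locality.\<close>

lemma fsa_pointwise:
  fixes w
  assumes D: "fsa_conf_cov_op r k D" and Y: "\<Upsilon> \<in> C_inf M" and us: "us \<in> tuples (C_inf M) (r - 1)"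
    and w: "w = - (real CARD('n) - 2 * k) / real r"
  shows "D M g us = exp_mult (real CARD('n) + w) \<Upsilon> (D M (conf_metric \<Upsilon> g) (map (exp_mult w \<Upsilon>) us))"
proof -
  interpret C: riemannian M "conf_metric \<Upsilon> g" by (rule riemannian_conf[OF Y])
  have P: "polydiff_op r D" and r: "r \<ge> 1"
    using D by (auto simp: fsa_conf_cov_op_def polydiff_op_def)
  have inv: "dirichlet_form D M (conf_metric \<Upsilon> g) (map (exp_mult w \<Upsilon>) vs) = dirichlet_form D M g vs"
    if "vs \<in> tuples (C_inf_compact M) r" for vs
    using D riemannian_manifold Y that unfolding fsa_conf_cov_op_def Let_def w by blast
  have tuple: "map (exp_mult w \<Upsilon>) vs \<in> tuples (C_inf M) (r - 1)" if "vs \<in> tuples (C_inf M) (r - 1)" for vs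
    using that C_inf_exp_mult[OF Y] by auto
  have compact: "D M g vs = exp_mult (real CARD('n) + w) \<Upsilon> (D M (conf_metric \<Upsilon> g) (map (exp_mult w \<Upsilon>) vs))"
    if vs: "vs \<in> tuples (C_inf_compact M) (r - 1)" for vs
  proof (rule C_inf_eq_by_test)
    let ?D' = "D M (conf_metric \<Upsilon> g) (map (exp_mult w \<Upsilon>) vs)"
    have vs': "vs \<in> tuples (C_inf M) (r - 1)" using vs C_inf_compact_imp by blast
    show "D M g vs \<in> C_inf M" by (rule polydiff_C_inf[OF P vs'])
    have D': "?D' \<in> C_inf M" by (rule C.polydiff_C_inf[OF P tuple[OF vs']])
    then show "exp_mult (real CARD('n) + w) \<Upsilon> ?D' \<in> C_inf M" by (rule C_inf_exp_mult[OF Y])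
    fix \<phi> assume \<phi>: "\<phi> \<in> C_inf_compact M"
    let ?f = "\<lambda>q. exp_mult w \<Upsilon> \<phi> q * ?D' q"
    have "?f \<in> C_inf M" using C_inf_mult[OF C_inf_exp_mult[OF Y C_inf_compact_imp[OF \<phi>]] D'] .
    then have f: "?f \<in> borel_measurable (vol M g)" by (rule C_inf_vol)
    have e: "(\<lambda>q. exp (real CARD('n) * \<Upsilon> q)) \<in> borel_measurable (vol M g)"
      using C_inf_vol[OF Y] by measurable
    have "\<phi> # vs \<in> tuples (C_inf_compact M) r" using \<phi> vs r by auto
    from inv[OF this] have "(\<integral>q. \<phi> q * D M g vs q \<partial>vol M g) = (\<integral>q. ?f q \<partial>vol M (conf_metric \<Upsilon> g))"
      by (simp add: dirichlet_form_def)
    \<comment> \<open>The volume contributes exp (n \<Upsilon>), and the test function, as first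
      argument of the form, contributes exp (w \<Upsilon>); hence the weight n + w.\<close>
    also have "\<dots> = (\<integral>q. exp (real CARD('n) * \<Upsilon> q) * ?f q \<partial>vol M g)"
      unfolding vol_conf[OF Y] using f e by (subst integral_density) auto
    also have "\<dots> = (\<integral>q. \<phi> q * exp_mult (real CARD('n) + w) \<Upsilon> ?D' q \<partial>vol M g)"
      by (rule Bochner_Integration.integral_cong) (simp_all add: exp_mult_def distrib_right exp_add)
    finally show "(\<integral>q. \<phi> q * D M g vs q \<partial>vol M g) =
        (\<integral>q. \<phi> q * exp_mult (real CARD('n) + w) \<Upsilon> ?D' q \<partial>vol M g)" .
  qed
  show ?thesis
  proof
    fix p
    show "D M g us p = exp_mult (real CARD('n) + w) \<Upsilon> (D M (conf_metric \<Upsilon> g) (map (exp_mult w \<Upsilon>) us)) p"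
    proof (cases "p \<in> points M")
      case False
      then show ?thesis
        using C_inf_zero_off[OF polydiff_C_inf[OF P us]]
          C_inf_zero_off[OF C.polydiff_C_inf[OF P tuple[OF us]]] by (simp add: exp_mult_def)
    next
      case True
      then obtain c where c: "c \<in> atlas M" "p \<in> cdom c" by (rule points_chart)
      obtain \<phi> V where \<phi>: "\<phi> \<in> C_inf_compact M" "openin (mtop M) V" "p \<in> V" "\<And>q. q \<in> V \<Longrightarrow> \<phi> q = (1::real)"
        using cutoff[OF c(1) chartD(1)[OF c(1)] order_refl c(2)] by metis
      define vs where "vs = map (\<lambda>u q. \<phi> q * u q) us"
      have vs: "vs \<in> tuples (C_inf_compact M) (r - 1)"
        using us C_inf_compact_mult[OF \<phi>(1)] by (auto simp: vs_def)
      then have vs': "vs \<in> tuples (C_inf M) (r - 1)" using C_inf_compact_imp by blast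
      have "D M g us p = D M g vs p"
        using \<phi>(4) by (intro polydiff_local[OF P us vs' \<phi>(2,3)]) (simp add: vs_def list_all2_conv_all_nth)
      moreover have "D M (conf_metric \<Upsilon> g) (map (exp_mult w \<Upsilon>) us) p =
          D M (conf_metric \<Upsilon> g) (map (exp_mult w \<Upsilon>) vs) p"
        using \<phi>(4) by (intro C.polydiff_local[OF P tuple[OF us] tuple[OF vs'] \<phi>(2,3)])
          (simp add: vs_def list_all2_conv_all_nth exp_mult_def)
      ultimately show ?thesis using compact[OF vs] by (simp add: exp_mult_def)
    qed
  qed
qed

section \<open>The conformal group and its action\<close>

lemma conf_groupD:
  assumes "F \<in> carrier (conf_group M g)"
  obtains \<Upsilon> where "F \<in> diffeos M" "\<Upsilon> \<in> C_inf M" "pullback_metric M F g = conf_metric \<Upsilon> g"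
  using assms by (auto simp: conf_group_def conformal_class_def)

lemma conf_groupI:
  "F \<in> diffeos M \<Longrightarrow> \<Upsilon> \<in> C_inf M \<Longrightarrow> pullback_metric M F g = conf_metric \<Upsilon> g \<Longrightarrow>
    F \<in> carrier (conf_group M g)"
  by (auto simp: conf_group_def conformal_class_def)

text \<open>The cocycle identity: the factor of F \<circ> G is \<Upsilon> \<circ> G + \<Upsilon>'.
  The coefficients 1 put it in the form of \<open>C_inf_lincomb\<close>.\<close>

lemma pullback_metric_compose_conf:
  assumes "F \<in> diffeos M" "pullback_metric M F g = conf_metric \<Upsilon> g"
    and "G \<in> diffeos M" "pullback_metric M G g = conf_metric \<Upsilon>' g"
  shows "pullback_metric M (compose (points M) F G) g = conf_metric (\<lambda>p. 1 * pullback M G \<Upsilon> p + 1 * \<Upsilon>' p) g"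
  using assms by (simp add: pullback_metric_compose diffeosD(2) pullback_metric_conf conf_metric_conf)

lemma restrict_id: "restrict id (points M) = (\<lambda>p\<in>points M. p)"
  by (simp add: restrict_def fun_eq_iff)

lemma group_conf_group: "group (conf_group M g)"
proof (rule groupI)
  fix F G assume F: "F \<in> carrier (conf_group M g)" and G: "G \<in> carrier (conf_group M g)"
  obtain \<Upsilon> where 1: "F \<in> diffeos M" "\<Upsilon> \<in> C_inf M" "pullback_metric M F g = conf_metric \<Upsilon> g"
    using F by (rule conf_groupD)
  obtain \<Upsilon>' where 2: "G \<in> diffeos M" "\<Upsilon>' \<in> C_inf M" "pullback_metric M G g = conf_metric \<Upsilon>' g"
    using G by (rule conf_groupD)
  have "compose (points M) F G \<in> carrier (conf_group M g)"
    by (rule conf_groupI[OF diffeos_compose[OF 1(1) 2(1)] _ pullback_metric_compose_conf[OF 1(1,3) 2(1,3)]])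
      (intro C_inf_lincomb pullback_C_inf[OF diffeosD(2)[OF 2(1)]] 1 2)
  then show "F \<otimes>\<^bsub>conf_group M g\<^esub> G \<in> carrier (conf_group M g)" by (simp add: conf_group_def)
next
  have "pullback_metric M (\<lambda>p\<in>points M. p) g = conf_metric (\<lambda>_. 0) g"
    by (simp add: pullback_metric_id[OF metric] conf_metric_zero)
  moreover have "(\<lambda>_. 0) \<in> C_inf M" using C_inf_const[of 0] by simp
  ultimately show "\<one>\<^bsub>conf_group M g\<^esub> \<in> carrier (conf_group M g)"
    using conf_groupI[OF diffeos_id] by (simp add: conf_group_def restrict_id)
next
  fix F G H assume "F \<in> carrier (conf_group M g)" "G \<in> carrier (conf_group M g)" "H \<in> carrier (conf_group M g)"
  then have "H \<in> points M \<rightarrow> points M" by (auto simp: conf_group_def dest: diffeosD(4))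
  from compose_assoc[OF this, of F G]
  show "F \<otimes>\<^bsub>conf_group M g\<^esub> G \<otimes>\<^bsub>conf_group M g\<^esub> H = F \<otimes>\<^bsub>conf_group M g\<^esub> (G \<otimes>\<^bsub>conf_group M g\<^esub> H)"
    by (simp add: conf_group_def)
next
  fix F assume F: "F \<in> carrier (conf_group M g)"
  obtain \<Upsilon> where 1: "F \<in> diffeos M" "\<Upsilon> \<in> C_inf M" "pullback_metric M F g = conf_metric \<Upsilon> g"
    using F by (rule conf_groupD)
  have B: "F \<in> Bij (points M)" by (rule diffeosD(1)[OF 1(1)])
  show "\<one>\<^bsub>conf_group M g\<^esub> \<otimes>\<^bsub>conf_group M g\<^esub> F = F"
    using Id_compose[OF Bij_imp_funcset[OF B] Bij_imp_extensional[OF B]]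
    by (simp add: conf_group_def restrict_id)
  let ?G = "dinv F"
  have G: "?G \<in> diffeos M" by (rule diffeos_dinv[OF 1(1)])
  \<comment> \<open>Pulling \<open>g\<close> back along F \<circ> F^-1 = id and solving for the
    factor of \<open>?G\<close> gives - \<Upsilon> \<circ> F^-1.\<close>
  have "compose (points M) F ?G = (\<lambda>p\<in>points M. p)"
    using diffeosD(7)[OF 1(1)] by (auto simp: compose_def fun_eq_iff)
  then have "g = pullback_metric M ?G (pullback_metric M F g)"
    using pullback_metric_compose[OF diffeosD(2)[OF 1(1)] diffeosD(2)[OF G], of g]
    by (simp add: pullback_metric_id[OF metric])
  then have "conf_metric (\<lambda>p. (- 1) * pullback M ?G \<Upsilon> p) g =
      conf_metric (\<lambda>p. (- 1) * pullback M ?G \<Upsilon> p) (conf_metric (pullback M ?G \<Upsilon>) (pullback_metric M ?G g))"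
    by (simp add: 1(3) pullback_metric_conf)
  then have "pullback_metric M ?G g = conf_metric (\<lambda>p. (- 1) * pullback M ?G \<Upsilon> p) g"
    by (simp add: conf_metric_conf conf_metric_zero)
  then have "?G \<in> carrier (conf_group M g)"
    by (rule conf_groupI[OF G C_inf_scale[OF pullback_C_inf[OF diffeosD(2)[OF G] 1(2)]]])
  moreover have "?G \<otimes>\<^bsub>conf_group M g\<^esub> F = \<one>\<^bsub>conf_group M g\<^esub>"
    using Bij_compose_restrict_eq[OF B] by (simp add: conf_group_def restrict_id dinv_def)
  ultimately show "\<exists>G\<in>carrier (conf_group M g). G \<otimes>\<^bsub>conf_group M g\<^esub> F = \<one>\<^bsub>conf_group M g\<^esub>" by blast
qed

text \<open>Pullback reverses composition, so with \<open>compose\<close> as product the action is a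
  right one. The weight \<open>w\<close> is an arbitrary real here.\<close>

lemma conf_act_right_action: "right_action (conf_group M g) (C_inf M) (conf_act M g w)"
  unfolding right_action_def
proof (intro conjI ballI group_conf_group)
  fix u assume u: "u \<in> C_inf M"
  have "(\<lambda>_. 0) \<in> C_inf M" using C_inf_const[of 0] by simp
  from conf_act_eq[OF this, of "\<lambda>p\<in>points M. p"]
  show "conf_act M g w u \<one>\<^bsub>conf_group M g\<^esub> = u"
    by (simp add: conf_group_def restrict_id pullback_metric_id[OF metric] conf_metric_zero
        exp_mult_def pullback_id[OF u])
  fix F assume "F \<in> carrier (conf_group M g)"
  then obtain \<Upsilon> where 1: "F \<in> diffeos M" "\<Upsilon> \<in> C_inf M" "pullback_metric M F g = conf_metric \<Upsilon> g"
    by (rule conf_groupD)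
  show "conf_act M g w u F \<in> C_inf M"
    unfolding conf_act_eq[OF 1(2,3)] by (intro C_inf_exp_mult 1 pullback_C_inf[OF diffeosD(2)] u)
  fix G assume "G \<in> carrier (conf_group M g)"
  then obtain \<Upsilon>' where 2: "G \<in> diffeos M" "\<Upsilon>' \<in> C_inf M" "pullback_metric M G g = conf_metric \<Upsilon>' g"
    by (rule conf_groupD)
  have "(\<lambda>p. 1 * pullback M G \<Upsilon> p + 1 * \<Upsilon>' p) \<in> C_inf M"
    by (intro C_inf_lincomb pullback_C_inf[OF diffeosD(2)[OF 2(1)]] 1 2)
  from conf_act_eq[OF this pullback_metric_compose_conf[OF 1(1,3) 2(1,3)]]
  have "conf_act M g w u (compose (points M) F G) =
     exp_mult (- w) (\<lambda>p. pullback M G \<Upsilon> p + \<Upsilon>' p) (pullback M G (pullback M F u))"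
    by (simp add: pullback_pullback[OF diffeosD(2)[OF 2(1)]])
  also have "\<dots> = exp_mult (- w) \<Upsilon>' (pullback M G (exp_mult (- w) \<Upsilon> (pullback M F u)))"
    by (simp add: exp_mult_def pullback_def fun_eq_iff distrib_left exp_diff exp_minus field_simps)
  also have "\<dots> = conf_act M g w (conf_act M g w u F) G"
    by (simp add: conf_act_eq[OF 1(2,3)] conf_act_eq[OF 2(2,3)])
  finally show "conf_act M g w u (F \<otimes>\<^bsub>conf_group M g\<^esub> G) = conf_act M g w (conf_act M g w u F) G"
    by (simp add: conf_group_def)
qed

end

section \<open>Invariance of the cone and of the equation\<close>

theorem lemma1p5:
  fixes D :: "('a, 'n::finite) polydiff"
    and \<C> :: "(nat \<times> ('a, 'n) polydiff) set"
    and M :: "('a, 'n) manifold" and g :: "'a metric"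
    and r :: nat and k n w :: real
  assumes "n = real CARD('n)"
    and "constrained_polydiff_op r k D \<C>"
    and "- 2 * k > - n"
    and "riemannian_manifold M g"
    and "w = - (n - 2 * k) / real r"
  shows "right_action (conf_group M g) (C_inf M) (conf_act M g w) \<and>
    (\<forall>\<Phi>\<in>carrier (conf_group M g). \<forall>u\<in>constrained_cone M g \<C>.
       conf_act M g w u \<Phi> \<in> constrained_cone M g \<C>) \<and>
    (\<forall>l::real. \<forall>\<Phi>\<in>carrier (conf_group M g). \<forall>u\<in>constrained_cone M g \<C>.
       D M g (replicate (r - 1) u) =
         (\<lambda>p. ((n - 2 * k) / real r) ^ (r - 1) * l *
              \<bar>u p\<bar> powr (((real r - 2) * n + 4 * k) / (n - 2 * k)) * u p) \<longrightarrow>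
       D M g (replicate (r - 1) (conf_act M g w u \<Phi>)) =
         (\<lambda>p. ((n - 2 * k) / real r) ^ (r - 1) * l *
              \<bar>conf_act M g w u \<Phi> p\<bar> powr (((real r - 2) * n + 4 * k) / (n - 2 * k)) *
              conf_act M g w u \<Phi> p))"
proof -
  interpret riemannian M g
    using assms(4) by unfold_locales (auto simp: riemannian_manifold_def)
  have D: "fsa_conf_cov_op r k D" using assms(2) by (simp add: constrained_polydiff_op_def)
  then have P: "polydiff_op r D" and r: "r \<ge> 1" by (auto simp: fsa_conf_cov_op_def polydiff_op_def)
  have action: "right_action (conf_group M g) (C_inf M) (conf_act M g w)"
    by (rule conf_act_right_action)
  have cone: "conf_act M g w u \<Phi> \<in> constrained_cone M g \<C>"
    if \<Phi>: "\<Phi> \<in> carrier (conf_group M g)" and u: "u \<in> constrained_cone M g \<C>" for \<Phi> u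
  proof -
    obtain \<Upsilon> where 1: "\<Phi> \<in> diffeos M" "\<Upsilon> \<in> C_inf M" "pullback_metric M \<Phi> g = conf_metric \<Upsilon> g"
      using \<Phi> by (rule conf_groupD)
    have uC: "u \<in> C_inf M" using u by (simp add: constrained_cone_def)
    let ?v = "conf_act M g w u \<Phi>"
    have "C M g (replicate (s - 1) ?v) p > 0" if C: "(s, C) \<in> \<C>" and p: "p \<in> points M" for s C p
    proof -
      have Pc: "polydiff_op s C" using C assms(2) by (auto simp: constrained_polydiff_op_def)
      obtain b where b: "\<And>v. v \<in> C_inf M \<Longrightarrow> C M (conf_metric \<Upsilon> g) (replicate (s - 1) v) =
          exp_mult b \<Upsilon> (C M g (replicate (s - 1) (exp_mult ((real CARD('n) - 2 * k) / real r) \<Upsilon> v)))"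
        using C assms(2,4) 1(2) unfolding constrained_polydiff_op_def by fast
      \<comment> \<open>The exponent in the law for \<open>C\<close> is - w, so at the pullback of
        \<open>u\<close> its right side evaluates \<open>C\<close> exactly at \<open>?v\<close>.
        Naturality turns the left side into the pullback of a positive function, and the exponential
        factor does not affect the sign.\<close>
      have "?v = exp_mult ((real CARD('n) - 2 * k) / real r) \<Upsilon> (pullback M \<Phi> u)"
        unfolding conf_act_eq[OF 1(2,3)] using assms(1,5) by (simp add: minus_divide_left)
      then have "exp_mult b \<Upsilon> (C M g (replicate (s - 1) ?v)) p =
          C M (conf_metric \<Upsilon> g) (replicate (s - 1) (pullback M \<Phi> u)) p"
        using b[OF pullback_C_inf[OF diffeosD(2)[OF 1(1)] uC]] by simp
      also have "\<dots> = pullback M \<Phi> (C M g (replicate (s - 1) u)) p"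
        \<comment> \<open>\<open>set_replicate_conv_if\<close> covers rank 1, where the list of
          arguments is empty.\<close>
        using polydiff_natural[OF Pc, of "replicate (s - 1) u" \<Phi>] uC 1(1) riemannian_conf[OF 1(2)]
        by (auto simp: 1(3) set_replicate_conv_if)
      also have "\<dots> > 0"
        using u C p diffeosD(4)[OF 1(1) p] by (auto simp: pullback_def constrained_cone_def)
      finally show ?thesis by (simp add: exp_mult_def zero_less_mult_iff)
    qed
    moreover have "?v \<in> C_inf M" using action uC \<Phi> by (simp add: right_action_def)
    ultimately show ?thesis by (auto simp: constrained_cone_def)
  qed
  have "D M g (replicate (r - 1) (conf_act M g w u \<Phi>)) p =
         ((n - 2 * k) / real r) ^ (r - 1) * l *
              \<bar>conf_act M g w u \<Phi> p\<bar> powr (((real r - 2) * n + 4 * k) / (n - 2 * k)) *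
              conf_act M g w u \<Phi> p"
    if \<Phi>: "\<Phi> \<in> carrier (conf_group M g)" and u: "u \<in> constrained_cone M g \<C>"
      and pde: "D M g (replicate (r - 1) u) =
         (\<lambda>p. ((n - 2 * k) / real r) ^ (r - 1) * l *
              \<bar>u p\<bar> powr (((real r - 2) * n + 4 * k) / (n - 2 * k)) * u p)" for \<Phi> u l p
  proof -
    obtain \<Upsilon> where 1: "\<Phi> \<in> diffeos M" "\<Upsilon> \<in> C_inf M" "pullback_metric M \<Phi> g = conf_metric \<Upsilon> g"
      using \<Phi> by (rule conf_groupD)
    have uC: "u \<in> C_inf M" using u by (simp add: constrained_cone_def)
    let ?v = "conf_act M g w u \<Phi>" and ?u = "pullback M \<Phi> u"
    define q where "q = ((real r - 2) * n + 4 * k) / (n - 2 * k)"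
    define K where "K = ((n - 2 * k) / real r) ^ (r - 1) * l"
    have v: "?v = exp_mult (- w) \<Upsilon> ?u" by (rule conf_act_eq[OF 1(2,3)])
    have vC: "?v \<in> C_inf M" using action uC \<Phi> by (simp add: right_action_def)
    \<comment> \<open>The factor of the action cancels, so the pointwise law at \<open>?v\<close>
      has the bare pullback of \<open>u\<close> on its right side, where naturality applies.\<close>
    have "exp_mult w \<Upsilon> ?v = ?u" by (simp add: v exp_mult_def mult.assoc[symmetric] exp_minus_inverse)
    moreover have "w = - (real CARD('n) - 2 * k) / real r" using assms(1,5) by simp
    ultimately have "D M g (replicate (r - 1) ?v) =
        exp_mult (n + w) \<Upsilon> (D M (conf_metric \<Upsilon> g) (replicate (r - 1) ?u))"
      using fsa_pointwise[OF D 1(2), of "replicate (r - 1) ?v" w] vC assms(1)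
      by (auto simp: set_replicate_conv_if)
    also have "D M (conf_metric \<Upsilon> g) (replicate (r - 1) ?u) = pullback M \<Phi> (D M g (replicate (r - 1) u))"
      using polydiff_natural[OF P, of "replicate (r - 1) u" \<Phi>] uC 1(1) riemannian_conf[OF 1(2)]
      by (auto simp: 1(3) set_replicate_conv_if)
    also have "\<dots> = (\<lambda>p. K * \<bar>?u p\<bar> powr q * ?u p)"
      unfolding pde by (auto simp: pullback_def K_def q_def)
    finally have "D M g (replicate (r - 1) ?v) p = exp ((n + w) * \<Upsilon> p) * (K * \<bar>?u p\<bar> powr q * ?u p)"
      by (simp add: exp_mult_def)
    \<comment> \<open>With a = - w \<Upsilon> p, multiplying y by exp a multiplies |y|^q y by exp (a
      q + a). What has to be verified is therefore - w (q + 1) = n + w, the equation that determines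
      q.\<close>
    also have "(n + w) * \<Upsilon> p = (- w * \<Upsilon> p) * q + (- w * \<Upsilon> p)"
    proof -
      have nz: "n - 2 * k \<noteq> 0" using assms(3) by simp
      define X where "X = (real r - 2) * n + 4 * k"
      have "- w = (n - 2 * k) / real r" by (simp add: assms(5) minus_divide_left)
      moreover have "q = X / (n - 2 * k)" by (simp add: q_def X_def)
      ultimately have "- w * q + - w = (X + (n - 2 * k)) / real r"
        using nz by (simp add: add_divide_distrib)
      also have "\<dots> = n + w" using r by (simp add: X_def assms(5) field_simps)
      finally have "- w * q + - w = n + w" .
      then have "(n + w) * \<Upsilon> p = (- w * q + - w) * \<Upsilon> p" by simp
      then show ?thesis by (simp add: algebra_simps)
    qed
    also have "exp \<dots> * (K * \<bar>?u p\<bar> powr q * ?u p) = K * \<bar>?v p\<bar> powr q * ?v p"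
    proof -
      have "exp (a * q + a) * (K * \<bar>y\<bar> powr q * y) = K * \<bar>exp a * y\<bar> powr q * (exp a * y)" for a y :: real
        by (simp add: abs_mult powr_mult exp_powr_real exp_add)
      then show ?thesis by (simp only: v exp_mult_def)
    qed
    finally show ?thesis by (simp add: K_def q_def)
  qed
  then show ?thesis using action cone by (intro conjI allI ballI impI ext) auto
qed

end
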